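(* Suppose that $F$ has a minimizer $x_*\in\mathbb{R}^d$, that $F$ is $L$-smooth, that $\{f_{i,p}\}$ has $\mathcal{V}$-bounded variance and that $F$ is $\mu$-strongly convex. Consider S-SGD-EF with constant step size $\eta_t=\eta$, with $\gamma=\Theta(k/d)$ sufficiently small and $T=\widetilde\Theta(1/(\eta\mu))$ sufficiently large. Then, for every $\varepsilon>0$, with an appropriate choice of $\eta>0$, the number $T$ of iterations of S-SGD-EF for achieving $\mathbb{E}[F(x_{\mathrm{out}})-F(x_* )]\le\varepsilon$ is $$\widetilde O\left(\frac L\mu+\frac{\mathcal{V}}{P}\frac1{\mu\varepsilon}+\frac dk+\frac{d}{k\sqrt P}\left(\frac L\mu+\frac{\sqrt{L\mathcal{V}}}{\mu\sqrt\varepsilon}\right)\right),$$ where $x_{\mathrm{out}}=x_{\hat t-1}$ and $\hat t\in[T]$ is random with $\Pr(\hat t=t)=(1-\eta\mu)^{-t}/\sum_{t'=1}^T(1-\eta\mu)^{-t'}$.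
   Context: Problem. $d,N,P$ are positive integers, $[m]=\{1,\dots,m\}$, $\|\cdot\|$ is the Euclidean norm, $f_{i,p}:\mathbb{R}^d\to\mathbb{R}$ ($i\in[N]$, $p\in[P]$) are differentiable, and $F(x)=\frac1P\sum_{p=1}^P\frac1N\sum_{i=1}^N f_{i,p}(x)$. Assumptions. $F$ is $L$-smooth ($L>0$): $\|\nabla F(x)-\nabla F(y)\|\le L\|x-y\|$ for all $x,y$. $\mathcal{V}$-bounded variance: $\frac1{NP}\sum_{i,p}\|\nabla f_{i,p}(x)-\nabla F(x)\|^2\le\mathcal{V}$ for all $x$. $F$ is $\mu$-strongly convex ($\mu>0$): $F(y)-(F(x)+\langle\nabla F(x),y-x\rangle)\ge\frac\mu2\|x-y\|^2$ for all $x,y$. Random compression. For $x\in\mathbb{R}^d$ and an integer $1\le k\le d$, $\mathrm{RandComp}(x,k)$ is the random vector obtained by drawing a subset $J\subset[d]$ uniformly among all subsets with $k$ elements (independently at each call) and setting the $j$-th coordinate to $(d/k)x_j$ if $j\in J$ and to $0$ otherwise. S-SGD-EF. Inputs: $x_{\mathrm{in}}\in\mathbb{R}^d$, step sizes $\eta_t>0$, $\gamma>0$, $k\in[d]$, $T$. Set $x_0=x_{\mathrm{in}}$, $m_{0,p}=0$ for $p\in[P]$. For $t=1,\dots,T$: for each $p$ draw $i_{t,p}$ uniformly from $[N]$ (independently over $t,p$); put $g_{t,p}=\nabla f_{i_{t,p},p}(x_{t-1})+\frac{\gamma}{\eta_t}m_{t-1,p}$, $\bar g_{t,p}=\mathrm{RandComp}(g_{t,p},k)$,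 $m_{t,p}=m_{t-1,p}+\eta_t(\nabla f_{i_{t,p},p}(x_{t-1})-\bar g_{t,p})$; then $x_t=x_{t-1}-\eta_t\frac1P\sum_{p=1}^P\bar g_{t,p}$. Conventions. "$\gamma=\Theta(k/d)$ sufficiently small" means $\gamma=c\,k/d$ with $c>0$ a sufficiently small absolute constant. $\widetilde O,\widetilde\Theta$ hide absolute constants and additional logarithmic factors in the problem parameters ($L,\mu,\mathcal{V},P,d,k,1/\varepsilon,\|x_0-x_*\|$); "$T=\widetilde\Theta(\cdot)$ sufficiently large" means the hidden factor is taken sufficiently large. *)

theory Defs
  imports "HOL-Probability.Probability"
begin

text \<open>
  The constants in the complexity bound must not depend on the dimension \<open>d\<close>, so \<open>d\<close> has to be
  quantified inside the formula and cannot be a type. We therefore realise all the spaces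
  \<open>\<real>\<^sup>d\<close> as the coordinate subspaces \<open>Rd d\<close> of one inner product space, the finitely supported
  real sequences; on \<open>Rd d\<close> its inner product, norm and topology are the Euclidean ones.
\<close>

typedef fsvec = "{x :: nat \<Rightarrow> real. finite {j. x j \<noteq> 0}}"
  morphisms coord Abs_fsvec
  by (rule exI[of _ "\<lambda>_. 0"]) simp

setup_lifting type_definition_fsvec

lemma finite_coord: "finite {j. coord x j \<noteq> 0}"
  using coord[of x] by simp

lemma fsvec_eq_iff: "x = y \<longleftrightarrow> (\<forall>j. coord x j = coord y j)"
  by (metis coord_inject ext)

instantiation fsvec :: real_vector
begin

lift_definition zero_fsvec :: fsvec is "\<lambda>_. 0" by simp

lift_definition plus_fsvec :: "fsvec \<Rightarrow> fsvec \<Rightarrow> fsvec" is "\<lambda>x y j. x j + y j"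
  subgoal for x y by (rule finite_subset[of _ "{j. x j \<noteq> 0} \<union> {j. y j \<noteq> 0}"]) auto
  done

lift_definition minus_fsvec :: "fsvec \<Rightarrow> fsvec \<Rightarrow> fsvec" is "\<lambda>x y j. x j - y j"
  subgoal for x y by (rule finite_subset[of _ "{j. x j \<noteq> 0} \<union> {j. y j \<noteq> 0}"]) auto
  done

lift_definition uminus_fsvec :: "fsvec \<Rightarrow> fsvec" is "\<lambda>x j. - x j" by simp

lift_definition scaleR_fsvec :: "real \<Rightarrow> fsvec \<Rightarrow> fsvec" is "\<lambda>r x j. r * x j"
  subgoal for r x by (rule finite_subset[of _ "{j. x j \<noteq> 0}"]) auto
  done

instance
  by (standard; transfer; simp add: fun_eq_iff algebra_simps)

end

lemmas coord_simps [simp] =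
  zero_fsvec.rep_eq plus_fsvec.rep_eq minus_fsvec.rep_eq uminus_fsvec.rep_eq scaleR_fsvec.rep_eq

instantiation fsvec :: real_inner
begin

definition inner_fsvec :: "fsvec \<Rightarrow> fsvec \<Rightarrow> real" where
  "inner_fsvec x y = (\<Sum>j | coord x j \<noteq> 0. coord x j * coord y j)"

definition norm_fsvec :: "fsvec \<Rightarrow> real" where
  "norm_fsvec x = sqrt (inner x x)"

definition sgn_fsvec :: "fsvec \<Rightarrow> fsvec" where
  "sgn_fsvec x = x /\<^sub>R norm x"

definition dist_fsvec :: "fsvec \<Rightarrow> fsvec \<Rightarrow> real" where
  "dist_fsvec x y = norm (x - y)"

definition uniformity_fsvec :: "(fsvec \<times> fsvec) filter" where
  "uniformity_fsvec = (INF e\<in>{0<..}. principal {(x, y). dist x y < e})"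

definition open_fsvec :: "fsvec set \<Rightarrow> bool" where
  "open_fsvec U \<longleftrightarrow> (\<forall>x\<in>U. \<forall>\<^sub>F (x', y) in uniformity. x' = x \<longrightarrow> y \<in> U)"

lemma inner_fsvec_on:
  assumes "finite S" and "{j. coord x j \<noteq> 0} \<subseteq> S"
  shows "inner x y = (\<Sum>j\<in>S. coord x j * coord y j)"
  unfolding inner_fsvec_def using assms by (intro sum.mono_neutral_left) auto

instance
proof
  fix x y z :: fsvec and r :: real
  let ?S = "{j. coord x j \<noteq> 0} \<union> {j. coord y j \<noteq> 0}"
  have S: "finite ?S" using finite_coord by simp
  show "inner x y = inner y x"
    by (simp add: inner_fsvec_on[OF S] mult.commute)
  have "{j. coord (x + y) j \<noteq> 0} \<subseteq> ?S" by auto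
  then show "inner (x + y) z = inner x z + inner y z"
    by (simp add: inner_fsvec_on[OF S] algebra_simps sum.distrib)
  have "{j. coord (r *\<^sub>R x) j \<noteq> 0} \<subseteq> ?S" by auto
  then show "inner (r *\<^sub>R x) y = r * inner x y"
    by (simp add: inner_fsvec_on[OF S] algebra_simps sum_distrib_left)
  show "0 \<le> inner x x"
    unfolding inner_fsvec_def by (intro sum_nonneg) auto
  have "inner x x = 0 \<longleftrightarrow> (\<forall>j\<in>{j. coord x j \<noteq> 0}. coord x j * coord x j = 0)"
    unfolding inner_fsvec_def by (rule sum_nonneg_eq_0_iff[OF finite_coord]) auto
  then show "inner x x = 0 \<longleftrightarrow> x = 0"
    by (auto simp: fsvec_eq_iff)
qed (simp_all add: norm_fsvec_def sgn_fsvec_def dist_fsvec_def uniformity_fsvec_def open_fsvec_def)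

end

definition Rd :: "nat \<Rightarrow> fsvec set" where
  "Rd d = {x. \<forall>j. j \<notin> {1..d} \<longrightarrow> coord x j = 0}"

lemma inner_Rd: "x \<in> Rd d \<Longrightarrow> inner x y = (\<Sum>j=1..d. coord x j * coord y j)"
  by (rule inner_fsvec_on) (auto simp: Rd_def)

lemma norm_Rd: "x \<in> Rd d \<Longrightarrow> norm x = sqrt (\<Sum>j=1..d. (coord x j)\<^sup>2)"
  by (simp add: norm_eq_sqrt_inner inner_Rd power2_eq_square)

text \<open>
  Derivatives are taken within \<open>Rd d\<close>, so the values of \<open>f\<close> outside \<open>Rd d\<close> are irrelevant.
  The side condition \<open>g \<in> Rd d\<close> makes the gradient unique.
\<close>

definition grad :: "nat \<Rightarrow> (fsvec \<Rightarrow> real) \<Rightarrow> fsvec \<Rightarrow> fsvec" where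
  "grad d f x = (THE g. g \<in> Rd d \<and> (f has_derivative (\<lambda>h. inner g h)) (at x within Rd d))"

definition avg_obj :: "nat \<Rightarrow> nat \<Rightarrow> (nat \<Rightarrow> nat \<Rightarrow> fsvec \<Rightarrow> real) \<Rightarrow> fsvec \<Rightarrow> real" where
  "avg_obj N P f x = 1 / real P * (\<Sum>p=1..P. 1 / real N * (\<Sum>i=1..N. f i p x))"

definition L_smooth :: "nat \<Rightarrow> real \<Rightarrow> (fsvec \<Rightarrow> real) \<Rightarrow> bool" where
  "L_smooth d L F \<longleftrightarrow>
     (\<forall>x\<in>Rd d. \<forall>y\<in>Rd d. norm (grad d F x - grad d F y) \<le> L * norm (x - y))"

definition bounded_variance ::
  "nat \<Rightarrow> nat \<Rightarrow> nat \<Rightarrow> real \<Rightarrow> (nat \<Rightarrow> nat \<Rightarrow> fsvec \<Rightarrow> real) \<Rightarrow> bool" where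
  "bounded_variance d N P V f \<longleftrightarrow>
     (\<forall>x\<in>Rd d. 1 / (real N * real P) *
        (\<Sum>i=1..N. \<Sum>p=1..P. (norm (grad d (f i p) x - grad d (avg_obj N P f) x))\<^sup>2) \<le> V)"

definition strongly_convex :: "nat \<Rightarrow> real \<Rightarrow> (fsvec \<Rightarrow> real) \<Rightarrow> bool" where
  "strongly_convex d \<mu> F \<longleftrightarrow>
     (\<forall>x\<in>Rd d. \<forall>y\<in>Rd d.
        F y - (F x + inner (grad d F x) (y - x)) \<ge> \<mu> / 2 * (norm (x - y))\<^sup>2)"

lift_definition scaled_restr :: "real \<Rightarrow> nat set \<Rightarrow> fsvec \<Rightarrow> fsvec" is
  "\<lambda>s J x j. if j \<in> J then s * x j else 0"
  subgoal for s J x by (rule finite_subset[of _ "{j. x j \<noteq> 0}"]) auto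
  done

definition rand_comp :: "nat \<Rightarrow> nat \<Rightarrow> fsvec \<Rightarrow> fsvec pmf" where
  "rand_comp d k x =
     map_pmf (\<lambda>J. scaled_restr (real d / real k) J x) (pmf_of_set {J. J \<subseteq> {1..d} \<and> card J = k})"

text \<open>
  One local computation: from the functions \<open>\<phi> i\<close> (\<open>i \<in> {1..N}\<close>) of a worker, the current point
  \<open>x\<close> and the worker's memory \<open>m\<close>, it yields the compressed gradient and the new memory.
\<close>

definition worker_step ::
  "nat \<Rightarrow> nat \<Rightarrow> nat \<Rightarrow> real \<Rightarrow> real \<Rightarrow> (nat \<Rightarrow> fsvec \<Rightarrow> real) \<Rightarrow> fsvec \<Rightarrow> fsvec \<Rightarrow> (fsvec \<times> fsvec) pmf"
where
  "worker_step d N k \<gamma> \<eta> \<phi> x m = do {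
     i \<leftarrow> pmf_of_set {1..N};
     let v = grad d (\<phi> i) x;
     gbar \<leftarrow> rand_comp d k (v + (\<gamma> / \<eta>) *\<^sub>R m);
     return_pmf (gbar, m + \<eta> *\<^sub>R (v - gbar))
   }"

text \<open>
  The state consists of the current point and the memories of the workers. The product
  distribution makes the workers independent; outside \<open>{1..P}\<close> memories are \<open>0\<close>.
\<close>

definition s_sgd_ef_step ::
  "nat \<Rightarrow> nat \<Rightarrow> nat \<Rightarrow> nat \<Rightarrow> real \<Rightarrow> (nat \<Rightarrow> nat \<Rightarrow> fsvec \<Rightarrow> real) \<Rightarrow> real \<Rightarrow>
   fsvec \<times> (nat \<Rightarrow> fsvec) \<Rightarrow> (fsvec \<times> (nat \<Rightarrow> fsvec)) pmf"
where
  "s_sgd_ef_step d N P k \<gamma> f \<eta> = (\<lambda>(x, m). do {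
     w \<leftarrow> Pi_pmf {1..P} (0, 0) (\<lambda>p. worker_step d N k \<gamma> \<eta> (\<lambda>i. f i p) x (m p));
     return_pmf (x - \<eta> *\<^sub>R ((1 / real P) *\<^sub>R (\<Sum>p=1..P. fst (w p))), \<lambda>p. snd (w p))
   })"

primrec s_sgd_ef ::
  "nat \<Rightarrow> nat \<Rightarrow> nat \<Rightarrow> nat \<Rightarrow> real \<Rightarrow> (nat \<Rightarrow> nat \<Rightarrow> fsvec \<Rightarrow> real) \<Rightarrow> (nat \<Rightarrow> real) \<Rightarrow> fsvec \<Rightarrow>
   nat \<Rightarrow> (fsvec \<times> (nat \<Rightarrow> fsvec)) pmf"
where
  "s_sgd_ef d N P k \<gamma> f \<eta> x_in 0 = return_pmf (x_in, \<lambda>_. 0)"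
| "s_sgd_ef d N P k \<gamma> f \<eta> x_in (Suc t) = do {
     s \<leftarrow> s_sgd_ef d N P k \<gamma> f \<eta> x_in t;
     s_sgd_ef_step d N P k \<gamma> f (\<eta> (Suc t)) s
   }"

definition out_index :: "real \<Rightarrow> real \<Rightarrow> nat \<Rightarrow> nat pmf" where
  "out_index \<eta> \<mu> T =
     embed_pmf (\<lambda>t. if t \<in> {1..T}
       then (1 - \<eta> * \<mu>) powi (- int t) / (\<Sum>t'=1..T. (1 - \<eta> * \<mu>) powi (- int t')) else 0)"

lemma pmf_out_index:
  assumes "\<eta> * \<mu> < 1" and "T \<ge> 1"
  shows "pmf (out_index \<eta> \<mu> T) t = (if t \<in> {1..T}
    then (1 - \<eta> * \<mu>) powi (- int t) / (\<Sum>t'=1..T. (1 - \<eta> * \<mu>) powi (- int t')) else 0)"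
proof -
  let ?w = "\<lambda>t. (1 - \<eta> * \<mu>) powi (- int t)"
  let ?p = "\<lambda>t. if t \<in> {1..T} then ?w t / (\<Sum>t'=1..T. ?w t') else 0"
  have w: "?w t > 0" for t
    using assms(1) by simp
  have S: "(\<Sum>t'=1..T. ?w t') > 0"
    using assms(2) w by (intro sum_pos) auto
  have nn: "0 \<le> ?p t" for t
    using S w[of t] by (simp add: less_imp_le)
  have "(\<integral>\<^sup>+t. ennreal (?p t) \<partial>count_space UNIV) = (\<Sum>t\<in>{1..T}. ennreal (?p t))"
    by (rule nn_integral_count_space') auto
  also have "\<dots> = ennreal (\<Sum>t\<in>{1..T}. ?p t)"
    using nn by (rule sum_ennreal)
  also have "(\<Sum>t\<in>{1..T}. ?p t) = (\<Sum>t\<in>{1..T}. ?w t) / (\<Sum>t'=1..T. ?w t')"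
    unfolding sum_divide_distrib by (rule sum.cong) auto
  also have "\<dots> = 1" using S by simp
  finally have "(\<integral>\<^sup>+t. ennreal (?p t) \<partial>count_space UNIV) = 1" by simp
  from pmf_embed_pmf[of ?p, OF nn this] show ?thesis
    unfolding out_index_def .
qed

text \<open>
  The law of \<open>x\<^bsub>t-1\<^esub>\<close> for an independent random \<open>t\<close>; since \<open>t - 1 < T\<close>, the iterate
  \<open>x\<^bsub>t-1\<^esub>\<close> of the run of length \<open>T\<close> is the last iterate of the run of length \<open>t - 1\<close>.
\<close>

definition x_out ::
  "nat \<Rightarrow> nat \<Rightarrow> nat \<Rightarrow> nat \<Rightarrow> real \<Rightarrow> (nat \<Rightarrow> nat \<Rightarrow> fsvec \<Rightarrow> real) \<Rightarrow> real \<Rightarrow> real \<Rightarrow> fsvec \<Rightarrow>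
   nat \<Rightarrow> fsvec pmf"
where
  "x_out d N P k \<gamma> f \<eta> \<mu> x_in T = do {
     t \<leftarrow> out_index \<eta> \<mu> T;
     (x, m) \<leftarrow> s_sgd_ef d N P k \<gamma> f (\<lambda>_. \<eta>) x_in (t - 1);
     return_pmf x
   }"

text \<open>
  Up to an absolute constant, every product of powers of logarithms \<open>ln (2 + a)\<close>, with \<open>a\<close> one
  of the parameters added up below, is at most some \<open>log_factor \<dots> ^ q\<close>. The summand 3 makes the
  factor at least 1.
\<close>

definition log_factor ::
  "real \<Rightarrow> real \<Rightarrow> real \<Rightarrow> nat \<Rightarrow> nat \<Rightarrow> nat \<Rightarrow> real \<Rightarrow> real \<Rightarrow> real"
where
  "log_factor L \<mu> V P d k \<epsilon> R = ln (3 + L + \<mu> + V + real P + real d + real k + 1 / \<epsilon> + R)"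

end

theory Submission
  imports Defs
begin

text \<open>
  Error feedback makes the virtual iterate \<open>z = x - b\<close>, with \<open>b\<close> the average memory, perform plain
  SGD, \<open>z\<^sub>t = z\<^bsub>t-1\<^esub> - \<eta> v\<^sub>t\<close>, except that the stochastic gradient \<open>v\<^sub>t\<close> is evaluated at
  \<open>x\<^bsub>t-1\<^esub> = z\<^bsub>t-1\<^esub> + b\<^bsub>t-1\<^esub>\<close>; the price is an error term of order \<open>\<eta> L \<parallel>b\<parallel>\<^sup>2\<close>. Each memory
  satisfies \<open>m\<^sub>t = (1 - \<gamma>) m\<^bsub>t-1\<^esub>\<close> plus a centred compression error, independent across the workers,
  so \<open>P \<parallel>b\<parallel>\<^sup>2\<close> and the mean of the \<open>\<parallel>m\<^sub>p\<parallel>\<^sup>2\<close> contract together at rate \<open>\<gamma>\<close>. Hence a suitable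
  combination of \<open>\<parallel>z - x\<^sub>*\<parallel>\<^sup>2\<close> and these two quantities contracts at rate \<open>\<eta> \<mu>\<close> up to noise, and
  loses \<open>\<eta> / 2\<close> times the optimality gap of \<open>x\<close> in each step. The weights of the output index
  telescope this recursion. The step size is the inverse of a sum with one term for each condition
  on it, which is \<open>\<mu>\<close> times the claimed complexity.
\<close>

section \<open>Gradients on the coordinate subspaces\<close>

lemma subspace_Rd: "subspace (Rd d)"
  by (auto simp: subspace_def Rd_def)

lemmas Rd_intros [intro] =
  subspace_0[OF subspace_Rd] subspace_add[OF subspace_Rd] subspace_diff[OF subspace_Rd]
  subspace_scale[OF subspace_Rd] subspace_sum[OF subspace_Rd]

lift_definition unit_vec :: "nat \<Rightarrow> fsvec" is "\<lambda>i j. if j = i then 1 else 0"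
  by simp

lemma unit_vec_in_Rd [simp]: "i \<in> {1..d} \<Longrightarrow> unit_vec i \<in> Rd d"
  by (auto simp: Rd_def unit_vec.rep_eq)

lemma coord_sum: "coord (sum g A) j = (\<Sum>a\<in>A. coord (g a) j)"
  by (induction A rule: infinite_finite_induct) auto

lemma Rd_expansion: "h \<in> Rd d \<Longrightarrow> h = (\<Sum>j=1..d. coord h j *\<^sub>R unit_vec j)"
  unfolding fsvec_eq_iff
  by (auto simp: coord_sum unit_vec.rep_eq Rd_def if_distrib[of "\<lambda>x. _ * x"] cong: if_cong)

text \<open>The difference \<open>g - g'\<close> lies in \<open>Rd d\<close>, so the line through
  \<open>x\<close> in that direction stays inside. Restricted to this line both derivatives belong
  to one function of a real variable, where derivatives are unique; hence \<open>g - g'\<close> is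
  orthogonal to itself.\<close>

lemma has_derivative_inner_unique:
  assumes x: "x \<in> Rd d" and g: "g \<in> Rd d" "g' \<in> Rd d"
    and D: "(f has_derivative (\<lambda>h. inner g h)) (at x within Rd d)"
           "(f has_derivative (\<lambda>h. inner g' h)) (at x within Rd d)"
  shows "g = g'"
proof -
  define h where "h = g - g'"
  have h: "h \<in> Rd d" using g by (auto simp: h_def)
  have *: "((\<lambda>t. f (x + t *\<^sub>R h)) has_derivative (\<lambda>t. inner a (t *\<^sub>R h))) (at 0)"
    if "(f has_derivative (\<lambda>h. inner a h)) (at x within Rd d)" for a
  proof (rule has_derivative_in_compose[of "\<lambda>t. x + t *\<^sub>R h" "\<lambda>t. t *\<^sub>R h" 0 UNIV f "inner a"])
    show "((\<lambda>t. x + t *\<^sub>R h) has_derivative (\<lambda>t. t *\<^sub>R h)) (at 0)"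
      by (auto intro!: derivative_eq_intros)
    have "range (\<lambda>t. x + t *\<^sub>R h) \<subseteq> Rd d" using x h by auto
    then show "(f has_derivative inner a) (at (x + 0 *\<^sub>R h) within range (\<lambda>t. x + t *\<^sub>R h))"
      using that by (auto intro: has_derivative_subset)
  qed
  have "inner g (1 *\<^sub>R h) = inner g' (1 *\<^sub>R h)"
    using has_derivative_unique[OF *[OF D(1)] *[OF D(2)]] by metis
  then have "inner h h = 0" by (simp add: h_def inner_diff_left)
  then show ?thesis by (simp add: h_def)
qed

lemma grad_eqI:
  assumes "x \<in> Rd d" "g \<in> Rd d" "(f has_derivative (\<lambda>h. inner g h)) (at x within Rd d)"
  shows "grad d f x = g"
  unfolding grad_def using assms by (intro the_equality) (auto intro: has_derivative_inner_unique)

text \<open>\<open>fsvec\<close> is not complete, so the representing vector is built explicitly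
  from the values of the derivative at the unit vectors. Agreement with the derivative on
  \<open>Rd d\<close> suffices, because the difference quotient sees no other directions.\<close>

lemma grad_works:
  assumes x: "x \<in> Rd d" and diff: "f differentiable_on Rd d"
  shows "grad d f x \<in> Rd d \<and> (f has_derivative (\<lambda>h. inner (grad d f x) h)) (at x within Rd d)"
proof -
  obtain f' where f': "(f has_derivative f') (at x within Rd d)"
    using x diff by (auto simp: differentiable_on_def differentiable_def)
  define g where "g = (\<Sum>j=1..d. f' (unit_vec j) *\<^sub>R unit_vec j)"
  have g: "g \<in> Rd d" by (auto simp: g_def intro!: subspace_sum[OF subspace_Rd])
  interpret bounded_linear f' using f' by (rule has_derivative_bounded_linear)
  have eq: "f' h = inner g h" if h: "h \<in> Rd d" for h
  proof -
    have "inner (unit_vec j) h = coord h j" if "j \<in> {1..d}" for j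
      using that by (subst inner_Rd[of _ d]) (auto simp: unit_vec.rep_eq if_distrib[of "\<lambda>x. x * _"] cong: if_cong)
    then have "inner g h = (\<Sum>j=1..d. coord h j * f' (unit_vec j))"
      unfolding g_def inner_sum_left inner_scaleR_left by (intro sum.cong) auto
    also have "\<dots> = f' (\<Sum>j=1..d. coord h j *\<^sub>R unit_vec j)"
      by (simp add: sum scaleR)
    finally show ?thesis using Rd_expansion[OF h] by simp
  qed
  have "(f has_derivative (\<lambda>h. inner g h)) (at x within Rd d)"
    unfolding has_derivative_def
  proof
    show "bounded_linear (inner g)" by (rule bounded_linear_inner_right)
    have "((\<lambda>y. (1 / norm (y - x)) *\<^sub>R (f y - (f x + f' (y - x)))) \<longlongrightarrow> 0) (at x within Rd d)"
      using f' by (simp add: has_derivative_within)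
    moreover have "\<forall>\<^sub>F y in at x within Rd d. y - x \<in> Rd d"
      using x by (auto simp: eventually_at_filter intro!: always_eventually)
    then have "\<forall>\<^sub>F y in at x within Rd d. (1 / norm (y - x)) *\<^sub>R (f y - (f x + f' (y - x)))
        = (1 / norm (y - x)) *\<^sub>R (f y - (f x + inner g (y - x)))"
      by eventually_elim (simp add: eq)
    ultimately have "((\<lambda>y. (1 / norm (y - x)) *\<^sub>R (f y - (f x + inner g (y - x)))) \<longlongrightarrow> 0) (at x within Rd d)"
      by (rule Lim_transform_eventually)
    \<comment> \<open>The base point appears here as the limit of the identity. This is
      \<open>x\<close> unless the filter is \<open>bot\<close>, along which every limit statement
      holds.\<close>
    then show "((\<lambda>y. (f y - f (Lim (at x within Rd d) (\<lambda>x. x)) - inner g (y - Lim (at x within Rd d) (\<lambda>x. x))) /\<^sub>R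
          norm (y - Lim (at x within Rd d) (\<lambda>x. x))) \<longlongrightarrow> 0) (at x within Rd d)"
      by (cases "at x within Rd d = bot") (auto simp: Lim_ident_at divide_simps algebra_simps)
  qed
  with g grad_eqI[OF x g this] show ?thesis by simp
qed

lemma avg_obj_grad:
  assumes x: "x \<in> Rd d"
    and diff: "\<forall>i\<in>{1..N}. \<forall>p\<in>{1..P}. f i p differentiable_on Rd d"
  shows "grad d (avg_obj N P f) x
    = (1 / real P) *\<^sub>R (\<Sum>p=1..P. (1 / real N) *\<^sub>R (\<Sum>i=1..N. grad d (f i p) x))"
proof (rule grad_eqI[OF x])
  have g: "grad d (f i p) x \<in> Rd d"
    "(f i p has_derivative (\<lambda>h. inner (grad d (f i p) x) h)) (at x within Rd d)"
    if "i \<in> {1..N}" "p \<in> {1..P}" for i p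
    using grad_works[OF x] diff that by auto
  show "(1 / real P) *\<^sub>R (\<Sum>p=1..P. (1 / real N) *\<^sub>R (\<Sum>i=1..N. grad d (f i p) x)) \<in> Rd d"
    using g by (intro subspace_scale[OF subspace_Rd] subspace_sum[OF subspace_Rd]) auto
  show "(avg_obj N P f has_derivative
     inner ((1 / real P) *\<^sub>R (\<Sum>p=1..P. (1 / real N) *\<^sub>R (\<Sum>i=1..N. grad d (f i p) x)))) (at x within Rd d)"
    unfolding avg_obj_def[abs_def]
    by (rule derivative_eq_intros g | assumption)+
      (auto simp: inner_sum_left fun_eq_iff)
qed

section \<open>Finitely supported expectations\<close>

text \<open>All laws in the algorithm have finite support, so integrability is automatic and
  expectations can be iterated freely.\<close>

lemma expectation_bind_finite:
  fixes h :: "'b \<Rightarrow> real"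
  assumes "finite (set_pmf p)" "\<And>x. x \<in> set_pmf p \<Longrightarrow> finite (set_pmf (q x))"
  shows "measure_pmf.expectation (bind_pmf p q) h
    = measure_pmf.expectation p (\<lambda>x. measure_pmf.expectation (q x) h)"
  using assms
  by (subst pmf_expectation_bind[of "set_pmf p"]) (auto simp: integral_measure_pmf[of "set_pmf p"])

lemma expectation_mono_finite:
  fixes h :: "'b \<Rightarrow> real"
  assumes "finite (set_pmf p)" "\<And>x. x \<in> set_pmf p \<Longrightarrow> g x \<le> h x"
  shows "measure_pmf.expectation p g \<le> measure_pmf.expectation p h"
  using assms by (intro integral_mono_AE) (auto simp: AE_measure_pmf_iff integrable_measure_pmf_finite)

lemma finite_set_Pi_pmf:
  assumes "finite A" "\<And>p. p \<in> A \<Longrightarrow> finite (set_pmf (q p))"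
  shows "finite (set_pmf (Pi_pmf A dflt q))"
  using assms by (auto simp: set_Pi_pmf intro!: finite_PiE_dflt)

text \<open>Centredness is tested against fixed vectors, since a vector-valued integral would need a
  complete space. It removes the cross term of the expanded square.\<close>

lemma expectation_norm_add_sq:
  fixes \<phi> :: "'a \<Rightarrow> 'b::real_inner"
  assumes fin: "finite (set_pmf q)" and mean: "\<And>u. measure_pmf.expectation q (\<lambda>y. inner (\<phi> y) u) = 0"
  shows "measure_pmf.expectation q (\<lambda>y. (norm (u + \<phi> y))\<^sup>2)
    = (norm u)\<^sup>2 + measure_pmf.expectation q (\<lambda>y. (norm (\<phi> y))\<^sup>2)"
proof -
  note [simp] = integrable_measure_pmf_finite[OF fin]
  have "measure_pmf.expectation q (\<lambda>y. (norm (u + \<phi> y))\<^sup>2)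
    = measure_pmf.expectation q (\<lambda>y. (norm u)\<^sup>2 + 2 * inner (\<phi> y) u + (norm (\<phi> y))\<^sup>2)"
    by (rule Bochner_Integration.integral_cong)
      (auto simp: power2_norm_eq_inner inner_simps inner_commute)
  also have "\<dots> = (norm u)\<^sup>2 + measure_pmf.expectation q (\<lambda>y. (norm (\<phi> y))\<^sup>2)"
    by (simp add: mean)
  finally show ?thesis .
qed

text \<open>The induction splits off one independent component and absorbs its value into the fixed
  vector, which is why \<open>u\<close> is arbitrary. Adding variances instead of norms is the
  source of every gain in \<open>P\<close>.\<close>

lemma expectation_norm_indep_sum_sq:
  fixes \<phi> :: "'a \<Rightarrow> 'c \<Rightarrow> 'b::real_inner"
  assumes "finite A" "\<And>p. p \<in> A \<Longrightarrow> finite (set_pmf (q p))"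
    and "\<And>p u. p \<in> A \<Longrightarrow> measure_pmf.expectation (q p) (\<lambda>y. inner (\<phi> p y) u) = 0"
  shows "measure_pmf.expectation (Pi_pmf A dflt q) (\<lambda>w. (norm (u + (\<Sum>p\<in>A. \<phi> p (w p))))\<^sup>2)
    = (norm u)\<^sup>2 + (\<Sum>p\<in>A. measure_pmf.expectation (q p) (\<lambda>y. (norm (\<phi> p y))\<^sup>2))"
  using assms
proof (induction A arbitrary: u rule: finite_induct)
  case empty
  then show ?case by simp
next
  case (insert a A)
  have fin: "finite (set_pmf (q a))" "finite (set_pmf (Pi_pmf A dflt q))"
    using insert by (auto intro!: finite_set_Pi_pmf)
  let ?h = "\<lambda>w. (norm (u + (\<Sum>p\<in>insert a A. \<phi> p (w p))))\<^sup>2"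
  have "measure_pmf.expectation (Pi_pmf (insert a A) dflt q) ?h
    = measure_pmf.expectation (pair_pmf (q a) (Pi_pmf A dflt q)) (\<lambda>(y, w). ?h (w(a := y)))"
    using insert by (simp add: Pi_pmf_insert split_def)
  also have "\<dots> = measure_pmf.expectation (q a) (\<lambda>y.
      measure_pmf.expectation (Pi_pmf A dflt q) (\<lambda>w. ?h (w(a := y))))"
    using fin by (simp add: pair_pmf_def expectation_bind_finite)
  also have "\<dots> = measure_pmf.expectation (q a) (\<lambda>y.
      measure_pmf.expectation (Pi_pmf A dflt q) (\<lambda>w. (norm ((u + \<phi> a y) + (\<Sum>p\<in>A. \<phi> p (w p))))\<^sup>2))"
  proof -
    have "?h (w(a := y)) = (norm ((u + \<phi> a y) + (\<Sum>p\<in>A. \<phi> p (w p))))\<^sup>2" for y w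
    proof -
      have "(\<Sum>p\<in>A. \<phi> p ((w(a := y)) p)) = (\<Sum>p\<in>A. \<phi> p (w p))"
        using insert by (intro sum.cong) auto
      then show ?thesis using insert by (simp add: add.assoc)
    qed
    then show ?thesis by simp
  qed
  also have "\<dots> = measure_pmf.expectation (q a) (\<lambda>y. (norm (u + \<phi> a y))\<^sup>2
      + (\<Sum>p\<in>A. measure_pmf.expectation (q p) (\<lambda>y. (norm (\<phi> p y))\<^sup>2)))"
    using insert by simp
  also have "\<dots> = measure_pmf.expectation (q a) (\<lambda>y. (norm (u + \<phi> a y))\<^sup>2)
      + (\<Sum>p\<in>A. measure_pmf.expectation (q p) (\<lambda>y. (norm (\<phi> p y))\<^sup>2))"
    using fin by (simp add: integrable_measure_pmf_finite)
  also have "measure_pmf.expectation (q a) (\<lambda>y. (norm (u + \<phi> a y))\<^sup>2)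
     = (norm u)\<^sup>2 + measure_pmf.expectation (q a) (\<lambda>y. (norm (\<phi> a y))\<^sup>2)"
    using fin insert by (intro expectation_norm_add_sq) auto
  finally show ?case using insert by simp
qed

lemma expectation_Pi_pmf_component:
  fixes h :: "'c \<Rightarrow> real"
  assumes "finite A" "p \<in> A"
  shows "measure_pmf.expectation (Pi_pmf A dflt q) (\<lambda>w. h (w p)) = measure_pmf.expectation (q p) h"
  using assms integral_map_pmf[of "\<lambda>w. w p" "Pi_pmf A dflt q" h] by (simp add: Pi_pmf_component)

section \<open>The compressor\<close>

lemma finite_subsets_card: "finite {J. J \<subseteq> {1..d::nat} \<and> card J = k}"
  by (rule finite_subset[of _ "Pow {1..d}"]) auto

lemma subsets_card_nonempty: "k \<le> d \<Longrightarrow> {J. J \<subseteq> {1..d::nat} \<and> card J = k} \<noteq> {}"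
  using obtain_subset_with_card_n[of k "{1..d}"] by fastforce

text \<open>Removing \<open>j\<close> matches the \<open>k\<close>-subsets containing
  \<open>j\<close> with the \<open>(k - 1)\<close>-subsets of the other \<open>d - 1\<close>
  elements; the quotient of the two binomial coefficients is \<open>k / d\<close>.\<close>

lemma inclusion_probability:
  assumes "1 \<le> k" "k \<le> d" "j \<in> {1..d::nat}"
  shows "measure_pmf.expectation (pmf_of_set {J. J \<subseteq> {1..d} \<and> card J = k}) (\<lambda>J. of_bool (j \<in> J))
    = real k / real d"
proof -
  let ?S = "{J. J \<subseteq> {1..d} \<and> card J = k}"
  have "{J \<in> ?S. j \<in> J} = insert j ` {J. J \<subseteq> {1..d} - {j} \<and> card J = k - 1}"
  proof (intro equalityI subsetI)
    fix J assume J: "J \<in> {J \<in> ?S. j \<in> J}"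
    then have "finite J" by (auto intro: finite_subset)
    with J have "J - {j} \<in> {J. J \<subseteq> {1..d} - {j} \<and> card J = k - 1}" by auto
    moreover have "J = insert j (J - {j})" using J by auto
    ultimately show "J \<in> insert j ` {J. J \<subseteq> {1..d} - {j} \<and> card J = k - 1}" by blast
  next
    fix J assume "J \<in> insert j ` {J. J \<subseteq> {1..d} - {j} \<and> card J = k - 1}"
    then obtain I where I: "J = insert j I" "I \<subseteq> {1..d} - {j}" "card I = k - 1" by auto
    then have "finite I" "j \<notin> I" by (auto intro: finite_subset)
    with I assms show "J \<in> {J \<in> ?S. j \<in> J}" by auto
  qed
  moreover have "inj_on (insert j) {J. J \<subseteq> {1..d} - {j} \<and> card J = k - 1}"
    by (auto simp: inj_on_def)
  ultimately have "card {J \<in> ?S. j \<in> J} = (d - 1) choose (k - 1)"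
    using assms by (simp add: card_image n_subsets)
  moreover have "card ?S = d choose k" by (simp add: n_subsets)
  moreover have "real k * real (d choose k) = real d * real ((d - 1) choose (k - 1))"
    using times_binomial_minus1_eq[of k d] assms by (simp flip: of_nat_mult)
  moreover have "d choose k > 0" using assms by simp
  ultimately show ?thesis
    using assms finite_subsets_card subsets_card_nonempty[of k d]
    by (subst integral_pmf_of_set) (auto simp: of_bool_def sum.If_cases Int_def field_simps)
qed

lemma scaled_restr_in_Rd [intro]: "x \<in> Rd d \<Longrightarrow> scaled_restr s J x \<in> Rd d"
  by (auto simp: Rd_def scaled_restr.rep_eq)

lemma finite_set_rand_comp [simp]: "k \<le> d \<Longrightarrow> finite (set_pmf (rand_comp d k x))"
  using finite_subsets_card subsets_card_nonempty[of k d] by (simp add: rand_comp_def)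

lemma rand_comp_in_Rd: "k \<le> d \<Longrightarrow> x \<in> Rd d \<Longrightarrow> y \<in> set_pmf (rand_comp d k x) \<Longrightarrow> y \<in> Rd d"
  by (auto simp: rand_comp_def)

text \<open>Mean and second moment of the compressor are both sums over the selected coordinates, so
  linearity and the inclusion probability give both; no joint law of two coordinates enters.\<close>

lemma expectation_rand_comp_coords:
  fixes a b :: "nat \<Rightarrow> real"
  assumes "1 \<le> k" "k \<le> d" "x \<in> Rd d"
    and h: "\<And>J. h (scaled_restr (real d / real k) J x) = (\<Sum>j=1..d. of_bool (j \<in> J) * a j)"
  shows "measure_pmf.expectation (rand_comp d k x) h = real k / real d * (\<Sum>j=1..d. a j)"
proof -
  let ?S = "pmf_of_set {J. J \<subseteq> {1..d} \<and> card J = k}"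
  have [simp]: "integrable (measure_pmf ?S) g" for g :: "nat set \<Rightarrow> real"
    using assms finite_subsets_card subsets_card_nonempty[of k d]
    by (intro integrable_measure_pmf_finite) simp
  have "measure_pmf.expectation (rand_comp d k x) h
    = (\<Sum>j=1..d. measure_pmf.expectation ?S (\<lambda>J. of_bool (j \<in> J)) * a j)"
    unfolding rand_comp_def integral_map_pmf h
    by (subst Bochner_Integration.integral_sum) (simp_all del: One_nat_def)
  also have "\<dots> = (\<Sum>j=1..d. real k / real d * a j)"
    using assms by (intro sum.cong refl, subst inclusion_probability) auto
  finally show ?thesis by (simp add: sum_distrib_left)
qed

lemma rand_comp_unbiased:
  assumes "1 \<le> k" "k \<le> d" "x \<in> Rd d"
  shows "measure_pmf.expectation (rand_comp d k x) (\<lambda>y. inner y u) = inner x u"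
proof -
  have "measure_pmf.expectation (rand_comp d k x) (\<lambda>y. inner y u)
    = real k / real d * (\<Sum>j=1..d. real d / real k * coord x j * coord u j)"
    using assms
    by (intro expectation_rand_comp_coords)
      (auto simp: inner_Rd[OF scaled_restr_in_Rd] scaled_restr.rep_eq intro!: sum.cong)
  also have "\<dots> = inner x u"
    using assms by (simp add: inner_Rd[OF assms(3)] sum_distrib_left)
  finally show ?thesis .
qed

text \<open>A coordinate survives with probability \<open>k / d\<close> and is then scaled by
  \<open>d / k\<close>, which makes the second moment \<open>d / k\<close> times the squared norm;
  unbiasedness subtracts the squared norm once.\<close>

lemma rand_comp_variance:
  assumes "1 \<le> k" "k \<le> d" "x \<in> Rd d"
  shows "measure_pmf.expectation (rand_comp d k x) (\<lambda>y. (norm (y - x))\<^sup>2)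
    = (real d / real k - 1) * (norm x)\<^sup>2"
proof -
  note [simp] = integrable_measure_pmf_finite[OF finite_set_rand_comp[OF assms(2)]]
  have "measure_pmf.expectation (rand_comp d k x) (\<lambda>y. inner y y)
    = real k / real d * (\<Sum>j=1..d. (real d / real k)\<^sup>2 * (coord x j)\<^sup>2)"
    using assms
    by (intro expectation_rand_comp_coords)
      (auto simp: inner_Rd[OF scaled_restr_in_Rd] scaled_restr.rep_eq power2_eq_square intro!: sum.cong)
  also have "\<dots> = real d / real k * inner x x"
    using assms by (simp add: inner_Rd[OF assms(3)] sum_distrib_left power2_eq_square)
  finally have *: "measure_pmf.expectation (rand_comp d k x) (\<lambda>y. inner y y) = real d / real k * inner x x" .
  have "measure_pmf.expectation (rand_comp d k x) (\<lambda>y. (norm (y - x))\<^sup>2)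
    = measure_pmf.expectation (rand_comp d k x) (\<lambda>y. inner y y - 2 * inner y x + inner x x)"
    by (rule Bochner_Integration.integral_cong)
      (auto simp: power2_norm_eq_inner inner_simps inner_commute)
  also have "\<dots> = (real d / real k - 1) * inner x x"
    by (simp add: * rand_comp_unbiased[OF assms] algebra_simps)
  finally show ?thesis by (simp add: power2_norm_eq_inner)
qed

section \<open>One step of S-SGD-EF\<close>

lemma finite_set_worker_step:
  assumes "N \<ge> 1" "k \<le> d"
  shows "finite (set_pmf (worker_step d N k \<gamma> \<eta> \<phi> x m))"
  using assms by (auto simp: worker_step_def Let_def)

lemma expectation_worker_step:
  fixes h :: "fsvec \<times> fsvec \<Rightarrow> real"
  assumes "N \<ge> 1" "k \<le> d"
  shows "measure_pmf.expectation (worker_step d N k \<gamma> \<eta> \<phi> x m) h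
    = (\<Sum>i=1..N. measure_pmf.expectation (rand_comp d k (grad d (\<phi> i) x + (\<gamma> / \<eta>) *\<^sub>R m))
        (\<lambda>g. h (g, m + \<eta> *\<^sub>R (grad d (\<phi> i) x - g)))) / real N"
  using assms unfolding worker_step_def Let_def map_pmf_def[symmetric]
  by (subst expectation_bind_finite) (auto simp: integral_pmf_of_set)

text \<open>
  Both the stochastic gradient and the centred part of the new memory can be read off the output
  \<open>y\<close> of a worker whose old memory is \<open>m\<close>.
\<close>

definition sampled_grad :: "real \<Rightarrow> fsvec \<Rightarrow> fsvec \<times> fsvec \<Rightarrow> fsvec" where
  "sampled_grad \<eta> m y = fst y + (1 / \<eta>) *\<^sub>R (snd y - m)"

definition memory_noise :: "real \<Rightarrow> fsvec \<Rightarrow> fsvec \<times> fsvec \<Rightarrow> fsvec" where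
  "memory_noise \<gamma> m y = snd y - (1 - \<gamma>) *\<^sub>R m"

lemma sampled_grad_worker [simp]:
  "\<eta> > 0 \<Longrightarrow> sampled_grad \<eta> m (g, m + \<eta> *\<^sub>R (v - g)) = v"
  by (simp add: sampled_grad_def)

text \<open>This is the purpose of the correction \<open>(\<gamma> / \<eta>) *\<^sub>R m\<close> in
  the compressed vector: the memory shrinks by the factor \<open>1 - \<gamma>\<close>, and what
  remains is the compression error, which has mean zero.\<close>

lemma memory_noise_worker:
  "\<eta> > 0 \<Longrightarrow> memory_noise \<gamma> m (g, m + \<eta> *\<^sub>R (v - g)) = (- \<eta>) *\<^sub>R (g - (v + (\<gamma> / \<eta>) *\<^sub>R m))"
  by (simp add: memory_noise_def fsvec_eq_iff field_simps)

context
  fixes d N k :: nat and \<gamma> \<eta> :: real and \<phi> :: "nat \<Rightarrow> fsvec \<Rightarrow> real" and x m :: fsvec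
  assumes N: "N \<ge> 1" and k: "1 \<le> k" "k \<le> d" and \<eta>: "\<eta> > 0"
    and v: "\<And>i. i \<in> {1..N} \<Longrightarrow> grad d (\<phi> i) x \<in> Rd d" and m: "m \<in> Rd d"
begin

private abbreviation "W \<equiv> worker_step d N k \<gamma> \<eta> \<phi> x m"

lemma comp_arg_in_Rd: "i \<in> {1..N} \<Longrightarrow> grad d (\<phi> i) x + (\<gamma> / \<eta>) *\<^sub>R m \<in> Rd d"
  using v m by auto

lemma worker_step_in_Rd: "y \<in> set_pmf W \<Longrightarrow> fst y \<in> Rd d \<and> snd y \<in> Rd d"
  using N rand_comp_in_Rd[OF k(2) comp_arg_in_Rd] v m
  by (fastforce simp: worker_step_def Let_def)

text \<open>The compressed message cancels from \<open>sampled_grad\<close>, so only the drawn index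
  remains random.\<close>

lemma expectation_sampled_grad:
  fixes h :: "fsvec \<Rightarrow> real"
  shows "measure_pmf.expectation W (\<lambda>y. h (sampled_grad \<eta> m y))
    = (\<Sum>i=1..N. h (grad d (\<phi> i) x)) / real N"
  using N k \<eta> by (simp add: expectation_worker_step)

lemma expectation_memory_noise:
  "measure_pmf.expectation W (\<lambda>y. inner (memory_noise \<gamma> m y) u) = 0"
proof -
  have "measure_pmf.expectation (rand_comp d k (grad d (\<phi> i) x + (\<gamma> / \<eta>) *\<^sub>R m))
     (\<lambda>g. inner (g - (grad d (\<phi> i) x + (\<gamma> / \<eta>) *\<^sub>R m)) u) = 0" if i: "i \<in> {1..N}" for i
    unfolding inner_diff_left
    by (subst Bochner_Integration.integral_diff)
      (simp_all add: rand_comp_unbiased[OF k comp_arg_in_Rd[OF i]] integrable_measure_pmf_finite k)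
  then show ?thesis
    using N k \<eta> by (simp add: expectation_worker_step memory_noise_worker)
qed

text \<open>The noise is \<eta> times the error of compressing the corrected gradient. The
  parallelogram law separates the gradient from the memory at the cost of a factor 2.\<close>

lemma expectation_memory_noise_sq:
  assumes \<gamma>: "\<gamma> \<ge> 0"
  shows "measure_pmf.expectation W (\<lambda>y. (norm (memory_noise \<gamma> m y))\<^sup>2)
    \<le> 2 * \<eta>\<^sup>2 * (real d / real k) * ((\<Sum>i=1..N. (norm (grad d (\<phi> i) x))\<^sup>2) / real N)
      + 2 * \<gamma>\<^sup>2 * (real d / real k) * (norm m)\<^sup>2"
proof -
  let ?q = "real d / real k"
  have "measure_pmf.expectation W (\<lambda>y. (norm (memory_noise \<gamma> m y))\<^sup>2)
    = (\<Sum>i=1..N. \<eta>\<^sup>2 * ((?q - 1) * (norm (grad d (\<phi> i) x + (\<gamma> / \<eta>) *\<^sub>R m))\<^sup>2)) / real N"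
    using N k \<eta> rand_comp_variance[OF k comp_arg_in_Rd]
    by (simp add: expectation_worker_step memory_noise_worker power_mult_distrib)
  also have "\<dots> \<le> (\<Sum>i=1..N. 2 * \<eta>\<^sup>2 * ?q * (norm (grad d (\<phi> i) x))\<^sup>2 + 2 * \<gamma>\<^sup>2 * ?q * (norm m)\<^sup>2) / real N"
  proof (intro divide_right_mono sum_mono)
    fix i
    let ?v = "grad d (\<phi> i) x"
    have "(norm (?v + (\<gamma> / \<eta>) *\<^sub>R m))\<^sup>2 + (norm (?v - (\<gamma> / \<eta>) *\<^sub>R m))\<^sup>2
      = 2 * (norm ?v)\<^sup>2 + 2 * (norm ((\<gamma> / \<eta>) *\<^sub>R m))\<^sup>2"
      unfolding power2_norm_eq_inner by (simp add: inner_simps inner_commute)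
    then have "(norm (?v + (\<gamma> / \<eta>) *\<^sub>R m))\<^sup>2 \<le> 2 * (norm ?v)\<^sup>2 + 2 * ((\<gamma> / \<eta>)\<^sup>2 * (norm m)\<^sup>2)"
      using zero_le_power2[of "norm (?v - (\<gamma> / \<eta>) *\<^sub>R m)"]
      unfolding norm_scaleR power_mult_distrib power2_abs by linarith
    then have "\<eta>\<^sup>2 * ((?q - 1) * (norm (?v + (\<gamma> / \<eta>) *\<^sub>R m))\<^sup>2)
      \<le> \<eta>\<^sup>2 * (?q * (2 * (norm ?v)\<^sup>2 + 2 * ((\<gamma> / \<eta>)\<^sup>2 * (norm m)\<^sup>2)))"
      using k by (intro mult_left_mono mult_mono) auto
    also have "\<dots> = 2 * \<eta>\<^sup>2 * ?q * (norm ?v)\<^sup>2 + 2 * \<gamma>\<^sup>2 * ?q * (norm m)\<^sup>2"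
      using \<eta> k by (simp add: field_simps power2_eq_square)
    finally show "\<eta>\<^sup>2 * ((?q - 1) * (norm (?v + (\<gamma> / \<eta>) *\<^sub>R m))\<^sup>2)
      \<le> 2 * \<eta>\<^sup>2 * ?q * (norm ?v)\<^sup>2 + 2 * \<gamma>\<^sup>2 * ?q * (norm m)\<^sup>2" .
  qed simp
  also have "\<dots> = 2 * \<eta>\<^sup>2 * ?q * ((\<Sum>i=1..N. (norm (grad d (\<phi> i) x))\<^sup>2) / real N)
      + 2 * \<gamma>\<^sup>2 * ?q * (norm m)\<^sup>2"
    using N by (simp add: sum.distrib sum_distrib_left add_divide_distrib sum_divide_distrib)
  finally show ?thesis .
qed

end

section \<open>The objective\<close>

text \<open>Expanding about the mean \<open>g\<close> leaves no cross term. With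
  \<open>u = 0\<close> this yields second moments of gradients; with the full gradient as
  \<open>u\<close> it shows that centring at a worker's own mean does not increase the
  deviation.\<close>

lemma mean_sq_decomp:
  fixes v :: "'a \<Rightarrow> 'b::real_inner"
  assumes "(\<Sum>a\<in>A. v a) = real (card A) *\<^sub>R g"
  shows "(\<Sum>a\<in>A. (norm (v a - u))\<^sup>2) = (\<Sum>a\<in>A. (norm (v a - g))\<^sup>2) + real (card A) * (norm (g - u))\<^sup>2"
proof -
  have "(norm (v a - u))\<^sup>2 = (norm (v a - g))\<^sup>2 + 2 * inner (v a - g) (g - u) + (norm (g - u))\<^sup>2" for a
    by (simp add: power2_norm_eq_inner inner_simps inner_commute)
  then have "(\<Sum>a\<in>A. (norm (v a - u))\<^sup>2) = (\<Sum>a\<in>A. (norm (v a - g))\<^sup>2)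
      + 2 * inner (\<Sum>a\<in>A. v a - g) (g - u) + real (card A) * (norm (g - u))\<^sup>2"
    by (simp add: sum.distrib inner_sum_left sum_distrib_left)
  then show ?thesis
    by (simp add: sum_subtractf assms sum_constant_scaleR)
qed

locale ef_problem =
  fixes d N P k :: nat and f :: "nat \<Rightarrow> nat \<Rightarrow> fsvec \<Rightarrow> real"
    and L \<mu> V :: real and x_star :: fsvec
  assumes d: "d \<ge> 1" and N: "N \<ge> 1" and P: "P \<ge> 1" and k: "1 \<le> k" "k \<le> d"
    and L: "L > 0" and \<mu>: "\<mu> > 0" and x_star: "x_star \<in> Rd d"
    and diff: "\<forall>i\<in>{1..N}. \<forall>p\<in>{1..P}. f i p differentiable_on Rd d"
    and minimizer: "\<forall>y\<in>Rd d. avg_obj N P f x_star \<le> avg_obj N P f y"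
    and smooth: "L_smooth d L (avg_obj N P f)"
    and variance: "bounded_variance d N P V f"
    and convex: "strongly_convex d \<mu> (avg_obj N P f)"
begin

abbreviation "F \<equiv> avg_obj N P f"
abbreviation "gap x \<equiv> F x - F x_star"
abbreviation "worker_grad p x \<equiv> (1 / real N) *\<^sub>R (\<Sum>i=1..N. grad d (f i p) x)"

lemma grad_f_in_Rd: "x \<in> Rd d \<Longrightarrow> i \<in> {1..N} \<Longrightarrow> p \<in> {1..P} \<Longrightarrow> grad d (f i p) x \<in> Rd d"
  using grad_works diff by blast

lemma grad_F: "x \<in> Rd d \<Longrightarrow> grad d F x = (1 / real P) *\<^sub>R (\<Sum>p=1..P. worker_grad p x)"
  by (rule avg_obj_grad[OF _ diff])

lemma grad_F_in_Rd: "x \<in> Rd d \<Longrightarrow> grad d F x \<in> Rd d"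
  unfolding grad_F using grad_f_in_Rd
  by (intro subspace_scale[OF subspace_Rd] subspace_sum[OF subspace_Rd]) auto

lemma convexD:
  "x \<in> Rd d \<Longrightarrow> y \<in> Rd d \<Longrightarrow> F y - (F x + inner (grad d F x) (y - x)) \<ge> \<mu> / 2 * (norm (x - y))\<^sup>2"
  using convex by (auto simp: strongly_convex_def)

lemma smoothD: "x \<in> Rd d \<Longrightarrow> y \<in> Rd d \<Longrightarrow> norm (grad d F x - grad d F y) \<le> L * norm (x - y)"
  using smooth by (auto simp: L_smooth_def)

lemma gap_nonneg: "x \<in> Rd d \<Longrightarrow> gap x \<ge> 0"
  using minimizer by auto

text \<open>
  Convexity turns Lipschitz continuity of the gradient directly into a quadratic upper bound
  (losing a factor 2); evaluate it at the gradient step of length \<open>1 / (2 * L)\<close>.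
\<close>

lemma norm_grad_sq_le:
  assumes x: "x \<in> Rd d"
  shows "(norm (grad d F x))\<^sup>2 \<le> 4 * L * gap x"
proof -
  define g where "g = grad d F x"
  define y where "y = x - (1 / (2 * L)) *\<^sub>R g"
  have y: "y \<in> Rd d" using x grad_F_in_Rd[OF x] by (auto simp: y_def g_def)
  have h: "y - x = (- 1 / (2 * L)) *\<^sub>R g" by (simp add: y_def)
  have "F x - F y \<ge> inner (grad d F y) (x - y)"
    using convexD[OF y x] \<mu> by (smt (verit) zero_le_power2 mult_nonneg_nonneg divide_nonneg_pos)
  then have "F y - F x \<le> inner (grad d F y) (y - x)"
    by (simp add: inner_diff_right)
  also have "\<dots> = inner g (y - x) + inner (grad d F y - g) (y - x)"
    by (simp add: inner_diff_left)
  also have "\<dots> \<le> inner g (y - x) + (L * norm (y - x)) * norm (y - x)"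
    using smoothD[OF y x] norm_cauchy_schwarz[of "grad d F y - g" "y - x"]
    by (smt (verit) g_def mult_right_mono norm_ge_zero)
  also have "\<dots> = - (norm g)\<^sup>2 / (4 * L)"
    unfolding h using L by (simp add: power2_eq_square norm_eq_sqrt_inner field_simps)
  finally have "(norm g)\<^sup>2 / (4 * L) \<le> F x - F y" by simp
  also have "\<dots> \<le> gap x" using minimizer y by auto
  finally show ?thesis using L by (simp add: g_def field_simps)
qed

text \<open>The gradient vanishes at \<open>x_star\<close>, because \<open>norm_grad_sq_le\<close>
  bounds it by a gap that is zero there; then strong convexity is applied from
  \<open>x_star\<close>.\<close>

lemma quadratic_growth:
  assumes x: "x \<in> Rd d"
  shows "\<mu> / 2 * (norm (x - x_star))\<^sup>2 \<le> gap x"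
proof -
  have "grad d F x_star = 0" using norm_grad_sq_le[OF x_star] by simp
  then show ?thesis using convexD[OF x_star x] by (simp add: norm_minus_commute)
qed

text \<open>Strong convexity used in both directions bounds the monotonicity of the gradient from
  below and smoothness bounds it from above; as \<open>d \<ge> 1\<close>, there is a nonzero vector
  to compare them on. \<open>virtual_descent\<close> uses this to absorb a multiple of \<mu> into
  one of \<open>L\<close>.\<close>

lemma \<mu>_le_L: "\<mu> \<le> L"
proof -
  define e where "e = unit_vec 1"
  have e: "e \<in> Rd d" "norm e > 0" and z: "0 \<in> Rd d"
    using d by (auto simp: e_def fsvec_eq_iff unit_vec.rep_eq intro!: exI[of _ 1])
  have "\<mu> * (norm e)\<^sup>2 \<le> inner (grad d F e - grad d F 0) e"
    using convexD[OF e(1) z] convexD[OF z e(1)] by (simp add: inner_diff_left)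
  also have "\<dots> \<le> norm (grad d F e - grad d F 0) * norm e" by (rule norm_cauchy_schwarz)
  also have "\<dots> \<le> (L * norm e) * norm e"
    using smoothD[OF e(1) z] by (intro mult_right_mono) auto
  finally show ?thesis using e(2) by (simp add: power2_eq_square)
qed

lemma sum_worker_grads:
  assumes "x \<in> Rd d"
  shows "(\<Sum>(i, p)\<in>{1..N} \<times> {1..P}. grad d (f i p) x) = real (card ({1..N} \<times> {1..P})) *\<^sub>R grad d F x"
proof -
  have "(\<Sum>(i, p)\<in>{1..N} \<times> {1..P}. grad d (f i p) x) = (\<Sum>p=1..P. \<Sum>i=1..N. grad d (f i p) x)"
    by (subst sum.swap) (simp add: sum.cartesian_product)
  then show ?thesis
    using N P by (simp add: grad_F[OF assms] scaleR_sum_right[symmetric])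
qed

lemma variance_sum:
  assumes "x \<in> Rd d"
  shows "(\<Sum>p=1..P. (\<Sum>i=1..N. (norm (grad d (f i p) x - grad d F x))\<^sup>2) / real N) \<le> real P * V"
proof -
  have "1 / (real N * real P) * (\<Sum>i=1..N. \<Sum>p=1..P. (norm (grad d (f i p) x - grad d F x))\<^sup>2) \<le> V"
    using variance assms by (auto simp: bounded_variance_def)
  then show ?thesis
    using N P by (subst (asm) sum.swap) (simp add: sum_divide_distrib[symmetric] field_simps)
qed

text \<open>The sign of \<open>V\<close> is not assumed; it follows because \<open>V\<close> bounds
  a mean of squares.\<close>

lemma V_nonneg: "V \<ge> 0"
proof -
  have "0 \<le> real P * V"
    using variance_sum[OF x_star] by (rule order_trans[rotated]) (auto intro!: sum_nonneg divide_nonneg_nonneg)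
  then show ?thesis using P by (simp add: zero_le_mult_iff)
qed

text \<open>Independence across workers needs each sampled gradient centred at the worker's own
  mean, while the variance assumption centres at the full gradient. The former deviation is the
  smaller one.\<close>

lemma worker_variance_sum:
  assumes "x \<in> Rd d"
  shows "(\<Sum>p=1..P. (\<Sum>i=1..N. (norm (grad d (f i p) x - worker_grad p x))\<^sup>2) / real N) \<le> real P * V"
proof -
  have "(\<Sum>i=1..N. (norm (grad d (f i p) x - worker_grad p x))\<^sup>2)
    \<le> (\<Sum>i=1..N. (norm (grad d (f i p) x - grad d F x))\<^sup>2)" for p
    using N by (subst mean_sq_decomp[of _ _ "worker_grad p x" "grad d F x"]) auto
  then have "(\<Sum>p=1..P. (\<Sum>i=1..N. (norm (grad d (f i p) x - worker_grad p x))\<^sup>2) / real N)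
    \<le> (\<Sum>p=1..P. (\<Sum>i=1..N. (norm (grad d (f i p) x - grad d F x))\<^sup>2) / real N)"
    by (rule sum_mono[OF divide_right_mono]) simp
  with variance_sum[OF assms] show ?thesis by linarith
qed

text \<open>This controls the size of what is compressed. The spread of the local gradients costs
  \<open>V\<close>, and their common mean is small near the minimizer.\<close>

lemma grad_second_moment:
  assumes x: "x \<in> Rd d"
  shows "(\<Sum>p=1..P. (\<Sum>i=1..N. (norm (grad d (f i p) x))\<^sup>2) / real N) \<le> real P * (V + 4 * L * gap x)"
proof -
  have swap: "(\<Sum>p=1..P. (\<Sum>i=1..N. h i p) / real N) = (\<Sum>a\<in>{1..N} \<times> {1..P}. h (fst a) (snd a)) / real N"
    for h :: "nat \<Rightarrow> nat \<Rightarrow> real"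
  proof -
    have "(\<Sum>p=1..P. \<Sum>i=1..N. h i p) = (\<Sum>a\<in>{1..N} \<times> {1..P}. h (fst a) (snd a))"
      by (subst sum.swap) (simp add: sum.cartesian_product split_def)
    then show ?thesis by (simp add: sum_divide_distrib[symmetric])
  qed
  have "(\<Sum>p=1..P. (\<Sum>i=1..N. (norm (grad d (f i p) x))\<^sup>2) / real N)
    = (\<Sum>a\<in>{1..N} \<times> {1..P}. (norm (grad d (f (fst a) (snd a)) x - 0))\<^sup>2) / real N"
    by (simp only: swap diff_zero)
  also have "\<dots> = ((\<Sum>a\<in>{1..N} \<times> {1..P}. (norm (grad d (f (fst a) (snd a)) x - grad d F x))\<^sup>2)
     + real (card ({1..N} \<times> {1..P})) * (norm (grad d F x - 0))\<^sup>2) / real N"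
    using sum_worker_grads[OF x] by (subst mean_sq_decomp[where g = "grad d F x"]) (simp_all add: split_def)
  also have "\<dots> = (\<Sum>p=1..P. (\<Sum>i=1..N. (norm (grad d (f i p) x - grad d F x))\<^sup>2) / real N)
     + real P * (norm (grad d F x))\<^sup>2"
    unfolding swap using N by (simp add: add_divide_distrib)
  also have "\<dots> \<le> real P * V + real P * (4 * L * gap x)"
    using variance_sum[OF x] norm_grad_sq_le[OF x] by (intro add_mono mult_left_mono) auto
  finally show ?thesis by (simp add: algebra_simps)
qed

end

section \<open>Descent of the potential\<close>

context ef_problem
begin

abbreviation avg_mem :: "(nat \<Rightarrow> fsvec) \<Rightarrow> fsvec" where
  "avg_mem m \<equiv> (1 / real P) *\<^sub>R (\<Sum>p=1..P. m p)"

text \<open>The descent sees only the averaged memory, but its noise is driven by the individual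
  memories. With the factor \<open>P\<close> both summands receive the same noise, the mean variance
  over the workers, so together they satisfy a closed recursion.\<close>

abbreviation mem_size :: "(nat \<Rightarrow> fsvec) \<Rightarrow> real" where
  "mem_size m \<equiv> real P * (norm (avg_mem m))\<^sup>2 + (\<Sum>p=1..P. (norm (m p))\<^sup>2) / real P"

abbreviation "workers \<gamma> \<eta> x m \<equiv>
  Pi_pmf {1..P} (0, 0) (\<lambda>p. worker_step d N k \<gamma> \<eta> (\<lambda>i. f i p) x (m p))"

lemma finite_set_workers: "finite (set_pmf (workers \<gamma> \<eta> x m))"
  using N k by (intro finite_set_Pi_pmf finite_set_worker_step) auto

lemma expectation_step:
  fixes h :: "fsvec \<times> (nat \<Rightarrow> fsvec) \<Rightarrow> real"
  shows "measure_pmf.expectation (s_sgd_ef_step d N P k \<gamma> f \<eta> (x, m)) h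
    = measure_pmf.expectation (workers \<gamma> \<eta> x m)
        (\<lambda>w. h (x - \<eta> *\<^sub>R ((1 / real P) *\<^sub>R (\<Sum>p=1..P. fst (w p))), \<lambda>p. snd (w p)))"
  by (simp add: s_sgd_ef_step_def map_pmf_def[symmetric])

context
  fixes \<gamma> \<eta> :: real and x :: fsvec and m :: "nat \<Rightarrow> fsvec"
  assumes \<eta>: "\<eta> > 0" and x: "x \<in> Rd d" and m: "\<And>p. m p \<in> Rd d"
begin

text \<open>Subtracting the average memory cancels all compressed messages, so the virtual iterate
  moves by the averaged sampled gradients. Its only noise is the sampling noise, reduced by
  \<open>P\<close> through independence.\<close>

lemma expectation_virtual_dist:
  "measure_pmf.expectation (workers \<gamma> \<eta> x m)
     (\<lambda>w. (norm (x - \<eta> *\<^sub>R ((1 / real P) *\<^sub>R (\<Sum>p=1..P. fst (w p))) - avg_mem (\<lambda>p. snd (w p)) - x_star))\<^sup>2)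
   \<le> (norm (x - avg_mem m - x_star - \<eta> *\<^sub>R grad d F x))\<^sup>2 + \<eta>\<^sup>2 * V / real P"
proof -
  define \<phi> where "\<phi> = (\<lambda>p y. (- \<eta> / real P) *\<^sub>R (sampled_grad \<eta> (m p) y - worker_grad p x))"
  define u where "u = x - avg_mem m - x_star - \<eta> *\<^sub>R grad d F x"
  let ?W = "\<lambda>p. worker_step d N k \<gamma> \<eta> (\<lambda>i. f i p) x (m p)"
  have eq: "x - \<eta> *\<^sub>R ((1 / real P) *\<^sub>R (\<Sum>p=1..P. fst (w p))) - avg_mem (\<lambda>p. snd (w p)) - x_star
    = u + (\<Sum>p\<in>{1..P}. \<phi> p (w p))" for w
  proof -
    have "\<phi> p (w p) = (\<eta> / real P) *\<^sub>R worker_grad p x - (\<eta> / real P) *\<^sub>R fst (w p)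
        - (1 / real P) *\<^sub>R snd (w p) + (1 / real P) *\<^sub>R m p" for p
      using \<eta> P by (simp add: \<phi>_def sampled_grad_def fsvec_eq_iff field_simps)
    then have "(\<Sum>p\<in>{1..P}. \<phi> p (w p)) = (\<eta> / real P) *\<^sub>R (\<Sum>p=1..P. worker_grad p x)
        - (\<eta> / real P) *\<^sub>R (\<Sum>p=1..P. fst (w p)) - avg_mem (\<lambda>p. snd (w p)) + avg_mem m"
      by (simp add: sum.distrib sum_subtractf scaleR_sum_right)
    then show ?thesis by (simp add: u_def grad_F[OF x])
  qed
  have mean: "measure_pmf.expectation (?W p) (\<lambda>y. inner (\<phi> p y) a) = 0" if "p \<in> {1..P}" for p a
  proof -
    have "measure_pmf.expectation (?W p) (\<lambda>y. inner (\<phi> p y) a)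
      = (\<Sum>i=1..N. inner ((- \<eta> / real P) *\<^sub>R (grad d (f i p) x - worker_grad p x)) a) / real N"
      unfolding \<phi>_def
      by (rule expectation_sampled_grad[OF N k \<eta> grad_f_in_Rd[OF x _ that] m,
        where h = "\<lambda>v. inner ((- \<eta> / real P) *\<^sub>R (v - worker_grad p x)) a"])
    also have "\<dots> = (- \<eta> / real P) * inner (\<Sum>i=1..N. grad d (f i p) x - worker_grad p x) a / real N"
      by (simp only: inner_sum_left inner_scaleR_left sum_distrib_left)
    also have "(\<Sum>i=1..N. grad d (f i p) x - worker_grad p x) = 0"
      using N by (simp add: sum_subtractf sum_constant_scaleR)
    finally show ?thesis by simp
  qed
  have sq: "measure_pmf.expectation (?W p) (\<lambda>y. (norm (\<phi> p y))\<^sup>2)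
     = (\<eta> / real P)\<^sup>2 * ((\<Sum>i=1..N. (norm (grad d (f i p) x - worker_grad p x))\<^sup>2) / real N)"
    if "p \<in> {1..P}" for p
    unfolding \<phi>_def
    using expectation_sampled_grad[OF N k \<eta> grad_f_in_Rd[OF x _ that] m,
        where h = "\<lambda>v. (norm ((- \<eta> / real P) *\<^sub>R (v - worker_grad p x)))\<^sup>2"] N
    by (simp add: power_mult_distrib power_divide sum_distrib_left[symmetric] sum_divide_distrib[symmetric])
  have "measure_pmf.expectation (workers \<gamma> \<eta> x m)
     (\<lambda>w. (norm (x - \<eta> *\<^sub>R ((1 / real P) *\<^sub>R (\<Sum>p=1..P. fst (w p))) - avg_mem (\<lambda>p. snd (w p)) - x_star))\<^sup>2)
    = measure_pmf.expectation (workers \<gamma> \<eta> x m) (\<lambda>w. (norm (u + (\<Sum>p\<in>{1..P}. \<phi> p (w p))))\<^sup>2)"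
    by (simp only: eq)
  also have "\<dots> = (norm u)\<^sup>2 + (\<Sum>p=1..P. measure_pmf.expectation (?W p) (\<lambda>y. (norm (\<phi> p y))\<^sup>2))"
    using mean N k by (intro expectation_norm_indep_sum_sq finite_set_worker_step) auto
  also have "(\<Sum>p=1..P. measure_pmf.expectation (?W p) (\<lambda>y. (norm (\<phi> p y))\<^sup>2))
    = (\<eta> / real P)\<^sup>2 * (\<Sum>p=1..P. (\<Sum>i=1..N. (norm (grad d (f i p) x - worker_grad p x))\<^sup>2) / real N)"
    by (simp add: sq sum_distrib_left)
  also have "\<dots> \<le> (\<eta> / real P)\<^sup>2 * (real P * V)"
    by (intro mult_left_mono worker_variance_sum x) auto
  also have "\<dots> = \<eta>\<^sup>2 * V / real P"
    using P by (simp add: field_simps power2_eq_square)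
  finally show ?thesis by (simp add: u_def)
qed

text \<open>Both summands decay by \<open>(1 - \<gamma>)\<^sup>2\<close> and gain the mean noise
  variance. The constant 4 is this doubling times the factor 2 in the bound on a single worker's
  noise.\<close>

lemma expectation_mem_size:
  assumes \<gamma>: "\<gamma> \<ge> 0"
  shows "measure_pmf.expectation (workers \<gamma> \<eta> x m) (\<lambda>w. mem_size (\<lambda>p. snd (w p)))
    \<le> ((1 - \<gamma>)\<^sup>2 + 4 * \<gamma>\<^sup>2 * (real d / real k)) * mem_size m
      + 4 * \<eta>\<^sup>2 * (real d / real k) * (V + 4 * L * gap x)"
proof -
  let ?W = "\<lambda>p. worker_step d N k \<gamma> \<eta> (\<lambda>i. f i p) x (m p)"
  let ?q = "real d / real k"
  define \<nu> where "\<nu> = (\<lambda>p. measure_pmf.expectation (?W p) (\<lambda>y. (norm (memory_noise \<gamma> (m p) y))\<^sup>2))"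
  define S where "S = (\<Sum>p=1..P. (norm (m p))\<^sup>2) / real P"
  note int = integrable_measure_pmf_finite[OF finite_set_workers]
  have finW: "finite (set_pmf (?W p))" for p
    using N k by (intro finite_set_worker_step) auto
  have mean: "measure_pmf.expectation (?W p) (\<lambda>y. inner (memory_noise \<gamma> (m p) y) a) = 0"
    if "p \<in> {1..P}" for p a
    by (rule expectation_memory_noise[OF N k \<eta> grad_f_in_Rd[OF x _ that] m])
  have avg: "measure_pmf.expectation (workers \<gamma> \<eta> x m) (\<lambda>w. (norm (avg_mem (\<lambda>p. snd (w p))))\<^sup>2)
    = (1 - \<gamma>)\<^sup>2 * (norm (avg_mem m))\<^sup>2 + (\<Sum>p=1..P. \<nu> p) / (real P)\<^sup>2"
  proof -
    have "avg_mem (\<lambda>p. snd (w p)) = (1 - \<gamma>) *\<^sub>R avg_mem m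
      + (\<Sum>p\<in>{1..P}. (1 / real P) *\<^sub>R memory_noise \<gamma> (m p) (w p))" for w
      by (simp add: memory_noise_def scaleR_sum_right[symmetric] sum_subtractf scaleR_diff_right)
    then have "measure_pmf.expectation (workers \<gamma> \<eta> x m) (\<lambda>w. (norm (avg_mem (\<lambda>p. snd (w p))))\<^sup>2)
      = measure_pmf.expectation (workers \<gamma> \<eta> x m) (\<lambda>w. (norm ((1 - \<gamma>) *\<^sub>R avg_mem m
      + (\<Sum>p\<in>{1..P}. (1 / real P) *\<^sub>R memory_noise \<gamma> (m p) (w p))))\<^sup>2)"
      by simp
    also have "\<dots> = (norm ((1 - \<gamma>) *\<^sub>R avg_mem m))\<^sup>2
      + (\<Sum>p=1..P. measure_pmf.expectation (?W p) (\<lambda>y. (norm ((1 / real P) *\<^sub>R memory_noise \<gamma> (m p) y))\<^sup>2))"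
      using finW mean by (intro expectation_norm_indep_sum_sq) auto
    also have "\<dots> = (1 - \<gamma>)\<^sup>2 * (norm (avg_mem m))\<^sup>2 + (\<Sum>p=1..P. \<nu> p) / (real P)\<^sup>2"
      by (simp add: \<nu>_def power_mult_distrib power_divide sum_divide_distrib)
    finally show ?thesis .
  qed
  have each: "measure_pmf.expectation (workers \<gamma> \<eta> x m) (\<lambda>w. (norm (snd (w p)))\<^sup>2)
    = (1 - \<gamma>)\<^sup>2 * (norm (m p))\<^sup>2 + \<nu> p" if p: "p \<in> {1..P}" for p
  proof -
    have "measure_pmf.expectation (workers \<gamma> \<eta> x m) (\<lambda>w. (norm (snd (w p)))\<^sup>2)
      = measure_pmf.expectation (?W p) (\<lambda>y. (norm ((1 - \<gamma>) *\<^sub>R m p + memory_noise \<gamma> (m p) y))\<^sup>2)"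
      using p by (subst expectation_Pi_pmf_component[where h = "\<lambda>y. (norm (snd y))\<^sup>2"])
        (auto simp: memory_noise_def)
    also have "\<dots> = (norm ((1 - \<gamma>) *\<^sub>R m p))\<^sup>2 + \<nu> p"
      unfolding \<nu>_def using finW mean[OF p] by (rule expectation_norm_add_sq)
    finally show ?thesis by (simp add: power_mult_distrib)
  qed
  have "(\<Sum>p=1..P. \<nu> p) \<le> (\<Sum>p=1..P. 2 * \<eta>\<^sup>2 * ?q * ((\<Sum>i=1..N. (norm (grad d (f i p) x))\<^sup>2) / real N)
      + 2 * \<gamma>\<^sup>2 * ?q * (norm (m p))\<^sup>2)"
    unfolding \<nu>_def by (intro sum_mono expectation_memory_noise_sq[OF N k \<eta> grad_f_in_Rd[OF x] m \<gamma>])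
  also have "\<dots> = 2 * \<eta>\<^sup>2 * ?q * (\<Sum>p=1..P. (\<Sum>i=1..N. (norm (grad d (f i p) x))\<^sup>2) / real N)
      + 2 * \<gamma>\<^sup>2 * ?q * (real P * S)"
  proof -
    have "real P * S = (\<Sum>p=1..P. (norm (m p))\<^sup>2)" unfolding S_def using P by simp
    then show ?thesis by (simp only: sum.distrib sum_distrib_left)
  qed
  also have "\<dots> \<le> 2 * \<eta>\<^sup>2 * ?q * (real P * (V + 4 * L * gap x)) + 2 * \<gamma>\<^sup>2 * ?q * (real P * S)"
    using grad_second_moment[OF x] by (intro add_right_mono mult_left_mono) auto
  finally have \<nu>: "(\<Sum>p=1..P. \<nu> p) / real P \<le> 2 * \<eta>\<^sup>2 * ?q * (V + 4 * L * gap x) + 2 * \<gamma>\<^sup>2 * ?q * S"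
    using P by (simp add: field_simps)
  have "measure_pmf.expectation (workers \<gamma> \<eta> x m) (\<lambda>w. mem_size (\<lambda>p. snd (w p)))
    = real P * ((1 - \<gamma>)\<^sup>2 * (norm (avg_mem m))\<^sup>2 + (\<Sum>p=1..P. \<nu> p) / (real P)\<^sup>2)
      + (\<Sum>p=1..P. (1 - \<gamma>)\<^sup>2 * (norm (m p))\<^sup>2 + \<nu> p) / real P"
    by (subst Bochner_Integration.integral_add[OF int int], subst integral_mult_right_zero,
      subst integral_divide_zero, subst Bochner_Integration.integral_sum[OF int], subst avg)
      (simp add: each del: One_nat_def)
  also have "\<dots> = (1 - \<gamma>)\<^sup>2 * mem_size m + 2 * ((\<Sum>p=1..P. \<nu> p) / real P)"
  proof -
    have "real P * ((\<Sum>p=1..P. \<nu> p) / (real P)\<^sup>2) = (\<Sum>p=1..P. \<nu> p) / real P"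
      using P by (simp add: power2_eq_square)
    then show ?thesis
      by (simp only: distrib_left sum.distrib add_divide_distrib sum_distrib_left[symmetric])
        (simp add: algebra_simps)
  qed
  also have "\<dots> \<le> (1 - \<gamma>)\<^sup>2 * mem_size m + 2 * (2 * \<eta>\<^sup>2 * ?q * (V + 4 * L * gap x) + 2 * \<gamma>\<^sup>2 * ?q * S)"
    using \<nu> by simp
  \<comment> \<open>\<open>S\<close> is the second summand of \<open>mem_size\<close> and the first
    is nonnegative; this closes the recursion.\<close>
  also have "\<dots> \<le> (1 - \<gamma>)\<^sup>2 * mem_size m
      + 2 * (2 * \<eta>\<^sup>2 * ?q * (V + 4 * L * gap x) + 2 * \<gamma>\<^sup>2 * ?q * mem_size m)"
    unfolding S_def by (intro add_left_mono mult_left_mono) auto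
  finally show ?thesis by (simp add: algebra_simps)
qed

end

text \<open>Convexity supplies \<open>2 * \<eta>\<close> times the gap. Evaluating the gradient at
  \<open>x\<close> instead of \<open>x - b\<close> costs \<open>\<eta> / 2\<close> of it, the
  squared gradient \<open>\<eta> / 4\<close>, and passing from the distance of \<open>x\<close> to
  that of \<open>x - b\<close> another \<open>\<eta> / 2\<close>, which leaves
  \<open>3 / 4 * \<eta>\<close>.\<close>

lemma virtual_descent:
  assumes \<eta>: "\<eta> > 0" "16 * L * \<eta> \<le> 1" and x: "x \<in> Rd d"
  shows "(norm (x - b - x_star - \<eta> *\<^sub>R grad d F x))\<^sup>2
    \<le> (1 - \<eta> * \<mu>) * (norm (x - b - x_star))\<^sup>2 - 3 / 4 * \<eta> * gap x + 16 * \<eta> * L * (norm b)\<^sup>2"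
proof -
  define G where "G = grad d F x"
  define y where "y = x - x_star"
  have yb: "x - b - x_star = y - b" by (simp add: y_def)
  have G: "(norm G)\<^sup>2 \<le> 4 * L * gap x" unfolding G_def by (rule norm_grad_sq_le[OF x])
  have inn: "inner G y \<ge> gap x + \<mu> / 2 * (norm y)\<^sup>2"
    using convexD[OF x x_star] by (simp add: G_def y_def inner_diff_right algebra_simps)
  have growth: "\<mu> / 2 * (norm y)\<^sup>2 \<le> gap x" unfolding y_def by (rule quadratic_growth[OF x])
  \<comment> \<open>The multiple \<open>8 * L\<close> of \<open>b\<close> in the square makes the
    gradient bound contribute exactly half a gap.\<close>
  have cross: "2 * inner G b \<le> gap x / 2 + 8 * L * (norm b)\<^sup>2"
  proof -
    have "0 \<le> (norm (G - (8 * L) *\<^sub>R b))\<^sup>2" by simp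
    also have "\<dots> = (norm G)\<^sup>2 - 16 * L * inner G b + 64 * L\<^sup>2 * (norm b)\<^sup>2"
      unfolding power2_norm_eq_inner by (simp add: inner_simps inner_commute power2_eq_square)
    finally have "16 * L * inner G b \<le> 4 * L * gap x + 64 * L\<^sup>2 * (norm b)\<^sup>2"
      using G by linarith
    also have "\<dots> = (8 * L) * (gap x / 2 + 8 * L * (norm b)\<^sup>2)"
      by (simp add: field_simps power2_eq_square)
    finally have "(8 * L) * (2 * inner G b) \<le> (8 * L) * (gap x / 2 + 8 * L * (norm b)\<^sup>2)"
      by (simp add: mult.assoc)
    then show ?thesis using L by (subst (asm) mult_le_cancel_left_pos) auto
  qed
  have young: "(norm (y - b))\<^sup>2 \<le> 5 / 4 * (norm y)\<^sup>2 + 5 * (norm b)\<^sup>2"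
  proof -
    have "0 \<le> (norm ((1 / 2) *\<^sub>R y + 2 *\<^sub>R b))\<^sup>2" by simp
    also have "\<dots> = 1 / 4 * (norm y)\<^sup>2 + 2 * inner y b + 4 * (norm b)\<^sup>2"
      unfolding power2_norm_eq_inner by (simp add: inner_simps inner_commute)
    finally show ?thesis
      unfolding power2_norm_eq_inner by (simp add: inner_simps inner_commute)
  qed
  have "(norm (y - b - \<eta> *\<^sub>R G))\<^sup>2
    = (norm (y - b))\<^sup>2 - 2 * \<eta> * inner G y + \<eta> * (2 * inner G b) + \<eta> * (\<eta> * (norm G)\<^sup>2)"
    unfolding power2_norm_eq_inner by (simp add: inner_simps inner_commute algebra_simps)
  also have "\<dots> \<le> (norm (y - b))\<^sup>2 - \<eta> * (2 * (gap x + \<mu> / 2 * (norm y)\<^sup>2))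
      + \<eta> * (gap x / 2 + 8 * L * (norm b)\<^sup>2) + \<eta> * (gap x / 4)"
  proof -
    have "\<eta> * (norm G)\<^sup>2 \<le> \<eta> * (4 * L * gap x)" using G \<eta> by (intro mult_left_mono) auto
    also have "\<dots> = (16 * L * \<eta>) * (gap x / 4)" by simp
    also have "\<dots> \<le> 1 * (gap x / 4)" using \<eta> gap_nonneg[OF x] by (intro mult_right_mono) auto
    finally have "\<eta> * (\<eta> * (norm G)\<^sup>2) \<le> \<eta> * (gap x / 4)"
      using \<eta> by (intro mult_left_mono) auto
    moreover have "\<eta> * (2 * inner G b) \<le> \<eta> * (gap x / 2 + 8 * L * (norm b)\<^sup>2)"
      using cross \<eta> by (intro mult_left_mono) auto
    moreover have "\<eta> * (2 * (gap x + \<mu> / 2 * (norm y)\<^sup>2)) \<le> \<eta> * (2 * inner G y)"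
      using inn \<eta> by (intro mult_left_mono) auto
    ultimately show ?thesis by simp
  qed
  also have "\<dots> = (norm (y - b))\<^sup>2 - 5 / 4 * \<eta> * gap x - \<eta> * \<mu> * (norm y)\<^sup>2 + 8 * \<eta> * L * (norm b)\<^sup>2"
    by (simp add: field_simps)
  \<comment> \<open>Half a gap is traded, by quadratic growth, for raising the coefficient of the
    squared distance from 1 to 5 / 4, the one that \<open>young\<close> requires.\<close>
  also have "\<dots> \<le> (norm (y - b))\<^sup>2 - 3 / 4 * \<eta> * gap x - \<eta> * \<mu> * (5 / 4 * (norm y)\<^sup>2) + 8 * \<eta> * L * (norm b)\<^sup>2"
    using mult_left_mono[OF growth, of "\<eta> / 2"] \<eta> by (simp add: field_simps)
  also have "\<dots> \<le> (norm (y - b))\<^sup>2 - 3 / 4 * \<eta> * gap x - \<eta> * \<mu> * ((norm (y - b))\<^sup>2 - 5 * (norm b)\<^sup>2)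
      + 8 * \<eta> * L * (norm b)\<^sup>2"
    using young \<eta> \<mu> by (intro add_right_mono diff_left_mono mult_left_mono) auto
  also have "\<dots> = (1 - \<eta> * \<mu>) * (norm (y - b))\<^sup>2 - 3 / 4 * \<eta> * gap x + \<eta> * (8 * L + 5 * \<mu>) * (norm b)\<^sup>2"
    by (simp add: algebra_simps)
  also have "\<dots> \<le> (1 - \<eta> * \<mu>) * (norm (y - b))\<^sup>2 - 3 / 4 * \<eta> * gap x + \<eta> * (16 * L) * (norm b)\<^sup>2"
    using \<mu>_le_L \<eta> L by (intro add_left_mono mult_right_mono mult_left_mono) auto
  finally show ?thesis unfolding yb G_def by (simp add: algebra_simps)
qed

section \<open>Invariance of the coordinate subspace and finite support along a run\<close>

lemma step_in_Rd:
  assumes \<eta>: "\<eta> > 0" and x: "x \<in> Rd d" and m: "\<And>p. m p \<in> Rd d"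
    and s: "(x', m') \<in> set_pmf (s_sgd_ef_step d N P k \<gamma> f \<eta> (x, m))"
  shows "x' \<in> Rd d" and "m' p \<in> Rd d"
proof -
  obtain w where w: "w \<in> set_pmf (workers \<gamma> \<eta> x m)"
    "x' = x - \<eta> *\<^sub>R ((1 / real P) *\<^sub>R (\<Sum>p=1..P. fst (w p)))" "m' = (\<lambda>p. snd (w p))"
    using s by (auto simp: s_sgd_ef_step_def)
  have wp: "fst (w p) \<in> Rd d \<and> snd (w p) \<in> Rd d" for p
  proof (cases "p \<in> {1..P}")
    case True
    then have wp: "w p \<in> set_pmf (worker_step d N k \<gamma> \<eta> (\<lambda>i. f i p) x (m p))"
      using w(1) by (auto simp: set_Pi_pmf PiE_dflt_def)
    show ?thesis
      by (rule worker_step_in_Rd[where \<phi> = "\<lambda>i. f i p", OF N k \<eta> grad_f_in_Rd[OF x _ True] m wp])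
  next
    \<comment> \<open>Outside \<open>{1..P}\<close> the product distribution returns the default
      \<open>(0, 0)\<close>.\<close>
    case False
    then show ?thesis using w(1) subspace_0[OF subspace_Rd]
      by (auto simp: set_Pi_pmf PiE_dflt_def)
  qed
  show "x' \<in> Rd d" unfolding w(2) using wp x
    by (intro subspace_diff[OF subspace_Rd] subspace_scale[OF subspace_Rd] subspace_sum[OF subspace_Rd]) auto
  show "m' p \<in> Rd d" using wp w(3) by auto
qed

lemma finite_set_step: "finite (set_pmf (s_sgd_ef_step d N P k \<gamma> f \<eta> s))"
  using finite_set_workers by (auto simp: s_sgd_ef_step_def split_def simp del: One_nat_def)

lemma finite_set_s_sgd_ef: "finite (set_pmf (s_sgd_ef d N P k \<gamma> f \<eta> x_in t))"
  by (induction t) (auto simp: finite_set_step)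

lemma s_sgd_ef_in_Rd:
  assumes "\<And>t. \<eta> t > 0" "x_in \<in> Rd d"
  shows "(x, m) \<in> set_pmf (s_sgd_ef d N P k \<gamma> f \<eta> x_in t) \<Longrightarrow> x \<in> Rd d \<and> (\<forall>p. m p \<in> Rd d)"
proof (induction t arbitrary: x m)
  case 0
  then show ?case using assms by (auto intro: subspace_0[OF subspace_Rd])
next
  case (Suc t)
  then obtain x0 m0 where s: "(x0, m0) \<in> set_pmf (s_sgd_ef d N P k \<gamma> f \<eta> x_in t)"
    "(x, m) \<in> set_pmf (s_sgd_ef_step d N P k \<gamma> f (\<eta> (Suc t)) (x0, m0))"
    by auto
  then show ?case using step_in_Rd[OF assms(1) _ _ s(2)] Suc.IH[OF s(1)] by blast
qed

end

text \<open>The last three conditions have one task each: \<open>\<eta>_L\<close> serves the virtual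
  descent, \<open>\<eta>_\<mu>\<close> lets half the decay of the memories outpace the rate
  \<open>\<eta> * \<mu>\<close>, and \<open>\<eta>_P\<close> keeps the gap fed into the memories by
  compression below the gap gained by descent.\<close>

locale ef_run = ef_problem +
  fixes c \<eta> :: real and x_in :: fsvec
  assumes c: "0 < c" "c \<le> 1 / 8" and \<eta>: "\<eta> > 0" and x_in: "x_in \<in> Rd d"
    and \<eta>_L: "16 * L * \<eta> \<le> 1"
    and \<eta>_\<mu>: "2 * (\<eta> * \<mu>) \<le> c * real k / real d"
    and \<eta>_P: "2048 * \<eta>\<^sup>2 * L\<^sup>2 * (real d / real k)\<^sup>2 \<le> c * real P"
begin

definition "\<gamma> = c * real k / real d"

text \<open>
  The weight of the memories is chosen such that their decay at rate \<open>\<gamma> / 2\<close> pays for the error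
  term \<open>16 * \<eta> * L * (norm b)\<^sup>2\<close> of the virtual descent.
\<close>

definition "mem_weight = 32 * \<eta> * L / (\<gamma> * real P)"

definition potential :: "fsvec \<times> (nat \<Rightarrow> fsvec) \<Rightarrow> real" where
  "potential s = (norm (fst s - avg_mem (snd s) - x_star))\<^sup>2 + mem_weight * mem_size (snd s)"

text \<open>The first term is the sampling noise of the virtual iterate; the second is the part of
  the weighted compression noise that comes from \<open>V\<close>, with
  \<open>\<gamma> = c * k / d\<close> inserted.\<close>

definition noise :: real where
  "noise = \<eta>\<^sup>2 * V / real P + 128 * \<eta>^3 * L * V * (real d / real k)\<^sup>2 / (c * real P)"

lemma \<gamma>_bounds: "0 < \<gamma>" "\<gamma> \<le> 1 / 8" "\<gamma> * (real d / real k) = c" "2 * (\<eta> * \<mu>) \<le> \<gamma>"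
proof -
  show "0 < \<gamma>" using c k d by (simp add: \<gamma>_def)
  have "c * (real k / real d) \<le> 1 / 8 * 1" using c k d by (intro mult_mono) auto
  then show "\<gamma> \<le> 1 / 8" by (simp add: \<gamma>_def)
  show "\<gamma> * (real d / real k) = c" using k d by (simp add: \<gamma>_def)
  show "2 * (\<eta> * \<mu>) \<le> \<gamma>" using \<eta>_\<mu> by (simp add: \<gamma>_def)
qed

lemma \<eta>\<mu>_bounds: "0 < \<eta> * \<mu>" "\<eta> * \<mu> < 1"
  using \<gamma>_bounds \<eta> \<mu> by auto

lemma mem_weight_nonneg: "mem_weight \<ge> 0"
  using \<gamma>_bounds \<eta> L by (simp add: mem_weight_def)

lemma mem_size_nonneg: "mem_size m \<ge> 0"
  by (intro add_nonneg_nonneg divide_nonneg_nonneg sum_nonneg) auto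

lemma potential_nonneg: "potential s \<ge> 0"
  unfolding potential_def using mem_weight_nonneg mem_size_nonneg by simp

lemma potential_step:
  assumes x: "x \<in> Rd d" and m: "\<And>p. m p \<in> Rd d"
  shows "measure_pmf.expectation (s_sgd_ef_step d N P k \<gamma> f \<eta> (x, m)) potential
    \<le> (1 - \<eta> * \<mu>) * potential (x, m) - \<eta> / 2 * gap x + noise"
proof -
  let ?q = "real d / real k"
  let ?W = "workers \<gamma> \<eta> x m"
  let ?b = "avg_mem m"
  let ?Y = "mem_size m"
  let ?Z = "(norm (x - ?b - x_star))\<^sup>2"
  note int = integrable_measure_pmf_finite[OF finite_set_workers]
  \<comment> \<open>Here the smallness of \<open>c\<close> enters:
    \<open>\<gamma> * (d / k) = c \<le> 1 / 8\<close> makes the compression noise caused by the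
    memories at most half of the decay rate.\<close>
  have decay: "(1 - \<gamma>)\<^sup>2 + 4 * \<gamma>\<^sup>2 * ?q \<le> 1 - \<gamma>"
  proof -
    have "4 * \<gamma>\<^sup>2 * ?q = 4 * \<gamma> * (\<gamma> * ?q)"
      by (simp add: power2_eq_square)
    also have "\<dots> = \<gamma> * (4 * c)"
      unfolding \<gamma>_bounds(3) by simp
    also have "\<dots> \<le> \<gamma> * (1 / 2)" using \<gamma>_bounds c by (intro mult_left_mono) auto
    finally have "4 * \<gamma>\<^sup>2 * ?q \<le> \<gamma> / 2" by simp
    moreover have "\<gamma>\<^sup>2 \<le> \<gamma> * (1 / 8)"
      unfolding power2_eq_square using \<gamma>_bounds by (intro mult_left_mono) auto
    ultimately show ?thesis using \<gamma>_bounds by (simp add: power2_diff)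
  qed
  have "measure_pmf.expectation (s_sgd_ef_step d N P k \<gamma> f \<eta> (x, m)) potential
    = measure_pmf.expectation ?W
     (\<lambda>w. (norm (x - \<eta> *\<^sub>R ((1 / real P) *\<^sub>R (\<Sum>p=1..P. fst (w p))) - avg_mem (\<lambda>p. snd (w p)) - x_star))\<^sup>2)
    + mem_weight * measure_pmf.expectation ?W (\<lambda>w. mem_size (\<lambda>p. snd (w p)))"
    unfolding expectation_step potential_def fst_conv snd_conv
    by (subst Bochner_Integration.integral_add[OF int int], subst integral_mult_right_zero) (rule refl)
  also have "\<dots> \<le> ((norm (x - ?b - x_star - \<eta> *\<^sub>R grad d F x))\<^sup>2 + \<eta>\<^sup>2 * V / real P)
    + mem_weight * (((1 - \<gamma>)\<^sup>2 + 4 * \<gamma>\<^sup>2 * ?q) * ?Y + 4 * \<eta>\<^sup>2 * ?q * (V + 4 * L * gap x))"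
    using \<gamma>_bounds mem_weight_nonneg
    by (intro add_mono mult_left_mono expectation_virtual_dist[OF \<eta> x m] expectation_mem_size[OF \<eta> x m]) auto
  also have "\<dots> \<le> ((1 - \<eta> * \<mu>) * ?Z - 3 / 4 * \<eta> * gap x + 16 * \<eta> * L * (norm ?b)\<^sup>2 + \<eta>\<^sup>2 * V / real P)
    + mem_weight * ((1 - \<gamma>) * ?Y + 4 * \<eta>\<^sup>2 * ?q * (V + 4 * L * gap x))"
    using mem_weight_nonneg L
    by (intro add_mono mult_left_mono mult_right_mono virtual_descent[OF \<eta> \<eta>_L x] decay mem_size_nonneg) auto
  also have "\<dots> \<le> (1 - \<eta> * \<mu>) * potential (x, m) - \<eta> / 2 * gap x + noise"
  proof -
    have "16 * \<eta> * L * (norm ?b)\<^sup>2 = mem_weight * \<gamma> / 2 * (real P * (norm ?b)\<^sup>2)"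
      using \<gamma>_bounds P by (simp add: mem_weight_def)
    also have "\<dots> \<le> mem_weight * \<gamma> / 2 * ?Y"
      using mem_weight_nonneg \<gamma>_bounds
      by (intro mult_left_mono) (auto intro!: sum_nonneg divide_nonneg_nonneg)
    finally have 1: "16 * \<eta> * L * (norm ?b)\<^sup>2 \<le> mem_weight * \<gamma> / 2 * ?Y" .
    \<comment> \<open>Half of the decay has been spent on the error term; the other half still beats
      \<open>\<eta> * \<mu>\<close>.\<close>
    have "mem_weight * ((1 - \<gamma> / 2) * ?Y) \<le> mem_weight * ((1 - \<eta> * \<mu>) * ?Y)"
      using \<gamma>_bounds mem_weight_nonneg mem_size_nonneg by (intro mult_left_mono mult_right_mono) auto
    moreover have "mem_weight * ((1 - \<gamma>) * Y) + mem_weight * \<gamma> / 2 * Y = mem_weight * ((1 - \<gamma> / 2) * Y)" for Y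
      by (simp add: field_simps)
    ultimately have 2: "mem_weight * ((1 - \<gamma>) * ?Y) + mem_weight * \<gamma> / 2 * ?Y \<le> mem_weight * ((1 - \<eta> * \<mu>) * ?Y)"
      by (simp only:)
    have mw: "mem_weight * (4 * \<eta>\<^sup>2 * ?q) = 128 * \<eta>^3 * L * ?q\<^sup>2 / (c * real P)"
      using \<gamma>_bounds(1) c d k P
      by (simp add: mem_weight_def \<gamma>_def power2_eq_square power3_eq_cube field_simps)
    \<comment> \<open>The constant of \<open>\<eta>_P\<close> arises here: the coefficient is
      \<open>512 * \<eta>^3 * L\<^sup>2\<close> times \<open>(d / k)\<^sup>2 / (c * P)\<close>, and
      it must not exceed \<open>\<eta> / 4\<close>, the excess of 3 / 4 over the 1 / 2 that is
      kept.\<close>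
    have 3: "mem_weight * (4 * \<eta>\<^sup>2 * ?q) * (4 * L * gap x) \<le> \<eta> / 4 * gap x"
    proof -
      have "mem_weight * (4 * \<eta>\<^sup>2 * ?q) * (4 * L)
        = \<eta> / 4 * ((2048 * \<eta>\<^sup>2 * L\<^sup>2 * ?q\<^sup>2) / (c * real P))"
        unfolding mw by (simp add: power2_eq_square power3_eq_cube)
      also have "\<dots> \<le> \<eta> / 4 * 1"
        using \<eta>_P \<eta> c P by (intro mult_left_mono) auto
      finally have "mem_weight * (4 * \<eta>\<^sup>2 * ?q) * (4 * L) \<le> \<eta> / 4" by simp
      from mult_right_mono[OF this gap_nonneg[OF x]] show ?thesis by (simp only: mult.assoc)
    qed
    have 4: "noise = \<eta>\<^sup>2 * V / real P + mem_weight * (4 * \<eta>\<^sup>2 * ?q) * V"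
      unfolding mw noise_def by simp
    have 5: "mem_weight * ((1 - \<gamma>) * ?Y + 4 * \<eta>\<^sup>2 * ?q * (V + 4 * L * gap x))
      = mem_weight * ((1 - \<gamma>) * ?Y) + mem_weight * (4 * \<eta>\<^sup>2 * ?q) * V
        + mem_weight * (4 * \<eta>\<^sup>2 * ?q) * (4 * L * gap x)"
      by (simp only: distrib_left mult.assoc add.assoc)
    have 6: "(1 - \<eta> * \<mu>) * potential (x, m) = (1 - \<eta> * \<mu>) * ?Z + mem_weight * ((1 - \<eta> * \<mu>) * ?Y)"
      by (simp add: potential_def algebra_simps)
    have 7: "\<eta> / 4 * gap x + \<eta> / 2 * gap x = 3 / 4 * \<eta> * gap x" by (simp add: algebra_simps)
    show ?thesis
      unfolding 4 5 6 using 1 2 3 7 by linarith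
  qed
  finally show ?thesis .
qed

section \<open>Summing the recursion along a run\<close>

abbreviation "run t \<equiv> s_sgd_ef d N P k \<gamma> f (\<lambda>_. \<eta>) x_in t"

lemma potential_run_Suc:
  "measure_pmf.expectation (run (Suc t)) potential
    \<le> (1 - \<eta> * \<mu>) * measure_pmf.expectation (run t) potential
      - \<eta> / 2 * measure_pmf.expectation (run t) (\<lambda>s. gap (fst s)) + noise"
proof -
  note [simp] = integrable_measure_pmf_finite[OF finite_set_s_sgd_ef]
  have "measure_pmf.expectation (run (Suc t)) potential
    = measure_pmf.expectation (run t) (\<lambda>s. measure_pmf.expectation (s_sgd_ef_step d N P k \<gamma> f \<eta> s) potential)"
    unfolding s_sgd_ef.simps
    by (rule expectation_bind_finite)
      (auto simp: finite_set_s_sgd_ef finite_set_step)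
  also have "\<dots> \<le> measure_pmf.expectation (run t)
     (\<lambda>s. (1 - \<eta> * \<mu>) * potential s - \<eta> / 2 * gap (fst s) + noise)"
  proof (rule expectation_mono_finite[OF finite_set_s_sgd_ef])
    fix s assume "s \<in> set_pmf (run t)"
    then show "measure_pmf.expectation (s_sgd_ef_step d N P k \<gamma> f \<eta> s) potential
      \<le> (1 - \<eta> * \<mu>) * potential s - \<eta> / 2 * gap (fst s) + noise"
      using potential_step[of "fst s" "snd s"] s_sgd_ef_in_Rd[OF \<eta> x_in, of "fst s" "snd s"] by auto
  qed
  also have "\<dots> = (1 - \<eta> * \<mu>) * measure_pmf.expectation (run t) potential
      - \<eta> / 2 * measure_pmf.expectation (run t) (\<lambda>s. gap (fst s)) + noise"
    by simp
  finally show ?thesis .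
qed

abbreviation weight :: "nat \<Rightarrow> real" where
  "weight t \<equiv> (1 - \<eta> * \<mu>) powi (- int t)"

text \<open>Since \<open>weight (Suc T) * (1 - \<eta> * \<mu>) = weight T\<close>, the weighted
  potentials telescope. Step \<open>t\<close> loses the gap at the point it starts from, so
  \<open>weight t\<close> goes with \<open>run (t - 1)\<close>, as in the output rule.\<close>

lemma weighted_gap_sum:
  "weight T * measure_pmf.expectation (run T) potential
    + \<eta> / 2 * (\<Sum>t=1..T. weight t * measure_pmf.expectation (run (t - 1)) (\<lambda>s. gap (fst s)))
   \<le> (norm (x_in - x_star))\<^sup>2 + noise * (\<Sum>t=1..T. weight t)"
proof (induction T)
  case 0
  \<comment> \<open>The memories start at zero, so the initial potential is the squared distance
    alone.\<close>
  show ?case by (simp add: potential_def)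
next
  case (Suc T)
  have w: "weight (Suc T) > 0" "weight (Suc T) * (1 - \<eta> * \<mu>) = weight T"
    using \<eta>\<mu>_bounds by (simp_all only: power_int_minus power_int_of_nat) simp_all
  have "weight (Suc T) * measure_pmf.expectation (run (Suc T)) potential
    \<le> weight (Suc T) * ((1 - \<eta> * \<mu>) * measure_pmf.expectation (run T) potential
      - \<eta> / 2 * measure_pmf.expectation (run T) (\<lambda>s. gap (fst s)) + noise)"
    using w by (intro mult_left_mono potential_run_Suc) auto
  also have "\<dots> = weight T * measure_pmf.expectation (run T) potential
      - \<eta> / 2 * (weight (Suc T) * measure_pmf.expectation (run T) (\<lambda>s. gap (fst s)))
      + noise * weight (Suc T)"
    unfolding w(2)[symmetric] by (simp add: algebra_simps)
  finally show ?case using Suc by (simp add: distrib_left)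
qed

lemma expectation_gap_out:
  assumes T: "T \<ge> 1"
  shows "measure_pmf.expectation (x_out d N P k \<gamma> f \<eta> \<mu> x_in T) gap
    \<le> 2 * (norm (x_in - x_star))\<^sup>2 / (\<eta> * exp (\<eta> * \<mu> * real T)) + 2 * noise / \<eta>"
proof -
  define S where "S = (\<Sum>t=1..T. weight t)"
  have w: "weight t > 0" for t using \<eta>\<mu>_bounds by simp
  have S: "S > 0" unfolding S_def using T w by (intro sum_pos) auto
  have supp: "set_pmf (out_index \<eta> \<mu> T) \<subseteq> {1..T}"
    using pmf_out_index[OF \<eta>\<mu>_bounds(2) T] by (auto simp: set_pmf_iff split: if_splits)
  \<comment> \<open>A lower bound on the total weight comes from its last summand alone; it makes
    the influence of the starting point exponentially small.\<close>
  have "exp (\<eta> * \<mu> * real T) \<le> weight T"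
  proof -
    have "1 - \<eta> * \<mu> \<le> exp (- (\<eta> * \<mu>))" using exp_ge_add_one_self[of "- (\<eta> * \<mu>)"] by simp
    then have "(1 - \<eta> * \<mu>) ^ T \<le> exp (- (\<eta> * \<mu>)) ^ T"
      using \<eta>\<mu>_bounds by (intro power_mono) auto
    also have "\<dots> = inverse (exp (\<eta> * \<mu> * real T))"
      by (simp add: exp_of_nat_mult[symmetric] exp_minus[symmetric] mult.commute)
    finally show ?thesis
      using \<eta>\<mu>_bounds by (simp add: power_int_minus field_simps)
  qed
  also have "\<dots> \<le> S" unfolding S_def using T w by (intro member_le_sum) (auto intro: less_imp_le)
  finally have exp_S: "exp (\<eta> * \<mu> * real T) \<le> S" .
  have "measure_pmf.expectation (x_out d N P k \<gamma> f \<eta> \<mu> x_in T) gap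
    = (\<Sum>t=1..T. pmf (out_index \<eta> \<mu> T) t * measure_pmf.expectation (run (t - 1)) (\<lambda>s. gap (fst s)))"
    unfolding x_out_def
    by (subst pmf_expectation_bind[OF _ _ supp])
      (auto simp: finite_set_s_sgd_ef split_def map_pmf_def[symmetric])
  also have "\<dots> = (\<Sum>t=1..T. weight t * measure_pmf.expectation (run (t - 1)) (\<lambda>s. gap (fst s))) / S"
    unfolding sum_divide_distrib
    by (intro sum.cong refl) (simp add: pmf_out_index[OF \<eta>\<mu>_bounds(2) T] S_def)
  also have "\<dots> \<le> (2 / \<eta> * ((norm (x_in - x_star))\<^sup>2 + noise * S)) / S"
  proof (rule divide_right_mono)
    have "0 \<le> weight T * measure_pmf.expectation (run T) potential"
      using w[of T] potential_nonneg by (intro mult_nonneg_nonneg integral_nonneg_AE) auto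
    then have "\<eta> / 2 * (\<Sum>t=1..T. weight t * measure_pmf.expectation (run (t - 1)) (\<lambda>s. gap (fst s)))
      \<le> (norm (x_in - x_star))\<^sup>2 + noise * S"
      using weighted_gap_sum[of T] unfolding S_def by linarith
    then show "(\<Sum>t=1..T. weight t * measure_pmf.expectation (run (t - 1)) (\<lambda>s. gap (fst s)))
      \<le> 2 / \<eta> * ((norm (x_in - x_star))\<^sup>2 + noise * S)"
      using \<eta> by (simp add: field_simps)
  qed (use S in simp)
  also have "\<dots> = 2 * (norm (x_in - x_star))\<^sup>2 / (\<eta> * S) + 2 * noise / \<eta>"
    using S \<eta> by (simp add: field_simps)
  also have "\<dots> \<le> 2 * (norm (x_in - x_star))\<^sup>2 / (\<eta> * exp (\<eta> * \<mu> * real T)) + 2 * noise / \<eta>"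
    using exp_S S \<eta> by (intro add_right_mono divide_left_mono mult_left_mono mult_pos_pos) auto
  finally show ?thesis .
qed

end

section \<open>Choice of the step size\<close>

text \<open>The terms enforce, in order: the virtual descent, small sampling noise, memory decay
  faster than \<open>\<eta> * \<mu>\<close>, and in the last product small feedback of the gap
  (\<open>64 * L\<close>) and small compression noise (the square root).\<close>

definition inv_step ::
  "real \<Rightarrow> real \<Rightarrow> real \<Rightarrow> real \<Rightarrow> real \<Rightarrow> real \<Rightarrow> real \<Rightarrow> real \<Rightarrow> real" where
  "inv_step c L \<mu> V P d k \<epsilon> = 16 * L + 8 * V / (P * \<epsilon>) + 2 * \<mu> * d / (c * k)
     + d / (k * sqrt (c * P)) * (64 * L + 32 * sqrt (L * V) / sqrt \<epsilon>)"

context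
  fixes c L \<mu> V P d k \<epsilon> :: real
  assumes c: "0 < c" "c \<le> 1 / 8" and L: "L > 0" and \<mu>: "\<mu> > 0" and V: "V \<ge> 0"
    and P: "P \<ge> 1" and k: "1 \<le> k" "k \<le> d" and \<epsilon>: "\<epsilon> > 0"
begin

private abbreviation "K \<equiv> inv_step c L \<mu> V P d k \<epsilon>"

lemma inv_step_ge:
  "16 * L \<le> K" "8 * V / (P * \<epsilon>) \<le> K" "2 * \<mu> * d / (c * k) \<le> K"
  "64 * L * (d / (k * sqrt (c * P))) \<le> K"
  "32 * sqrt (L * V) / sqrt \<epsilon> * (d / (k * sqrt (c * P))) \<le> K"
proof -
  have "0 \<le> 16 * L" "0 \<le> 8 * V / (P * \<epsilon>)" "0 \<le> 2 * \<mu> * d / (c * k)"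
    "0 \<le> 64 * L * (d / (k * sqrt (c * P)))"
    "0 \<le> 32 * sqrt (L * V) / sqrt \<epsilon> * (d / (k * sqrt (c * P)))"
    using c L \<mu> V P k \<epsilon> by simp_all
  moreover have "K = 16 * L + 8 * V / (P * \<epsilon>) + 2 * \<mu> * d / (c * k)
    + 64 * L * (d / (k * sqrt (c * P))) + 32 * sqrt (L * V) / sqrt \<epsilon> * (d / (k * sqrt (c * P)))"
    by (simp add: inv_step_def distrib_left mult.commute)
  ultimately show "16 * L \<le> K" "8 * V / (P * \<epsilon>) \<le> K" "2 * \<mu> * d / (c * k) \<le> K"
    "64 * L * (d / (k * sqrt (c * P))) \<le> K"
    "32 * sqrt (L * V) / sqrt \<epsilon> * (d / (k * sqrt (c * P))) \<le> K"
    by linarith+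
qed

lemma inv_step_pos: "K > 0"
  using inv_step_ge(1) L by linarith

lemma inv_step_\<mu>: "2 * (1 / K * \<mu>) \<le> c * k / d"
  using inv_step_ge(3) inv_step_pos c k by (simp add: field_simps)

text \<open>The conditions involving compression are quadratic in the step size; stating them
  through square roots is what produces \<open>d / (k * sqrt P)\<close> in the complexity.\<close>

lemma sq_le_inv_step:
  assumes "0 \<le> a" "a * (d / (k * sqrt (c * P))) \<le> K"
  shows "a\<^sup>2 * (d / k)\<^sup>2 \<le> K\<^sup>2 * (c * P)"
proof -
  have "(a * (d / (k * sqrt (c * P))))\<^sup>2 \<le> K\<^sup>2"
    using assms c P k by (intro power_mono) auto
  moreover have "(a * (d / (k * sqrt (c * P))))\<^sup>2 = a\<^sup>2 * (d / k)\<^sup>2 / (c * P)"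
    using c P by (simp add: power_mult_distrib power_divide)
  ultimately show ?thesis using c P by (simp add: pos_divide_le_eq)
qed

lemma inv_step_P: "2048 * (1 / K)\<^sup>2 * L\<^sup>2 * (d / k)\<^sup>2 \<le> c * P"
proof -
  have "2048 * (L\<^sup>2 * (d / k)\<^sup>2) \<le> 4096 * (L\<^sup>2 * (d / k)\<^sup>2)"
    by (intro mult_right_mono) auto
  also have "\<dots> = (64 * L)\<^sup>2 * (d / k)\<^sup>2" by (simp add: power_mult_distrib)
  also have "\<dots> \<le> K\<^sup>2 * (c * P)"
    using L by (intro sq_le_inv_step inv_step_ge(4)) auto
  finally have "2048 * (L\<^sup>2 * (d / k)\<^sup>2) / K\<^sup>2 \<le> c * P"
    using inv_step_pos by (simp add: pos_divide_le_eq mult.commute)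
  then show ?thesis by (simp add: power_divide mult_ac)
qed

text \<open>The left-hand side is \<open>2 * noise / \<eta>\<close> for the step
  \<open>1 / K\<close>. Each of its two terms gets \<open>\<epsilon> / 4\<close>, which leaves
  \<open>\<epsilon> / 2\<close> for the starting point.\<close>

lemma inv_step_noise:
  "2 * ((1 / K) * V / P) + 256 * ((1 / K)\<^sup>2 * L * V * (d / k)\<^sup>2 / (c * P)) \<le> \<epsilon> / 2"
proof -
  have "2 * ((1 / K) * V / P) \<le> \<epsilon> / 4"
    using inv_step_ge(2) inv_step_pos P \<epsilon> by (simp add: field_simps)
  moreover have "256 * ((1 / K)\<^sup>2 * L * V * (d / k)\<^sup>2 / (c * P)) \<le> \<epsilon> / 4"
  proof -
    \<comment> \<open>The square of 32 is four times 256, which gives the quarter of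
      \<open>\<epsilon>\<close>.\<close>
    have "(32 * sqrt (L * V) / sqrt \<epsilon>)\<^sup>2 * (d / k)\<^sup>2 \<le> K\<^sup>2 * (c * P)"
      using L V \<epsilon> by (intro sq_le_inv_step inv_step_ge(5)) auto
    moreover have "(32 * sqrt (L * V) / sqrt \<epsilon>)\<^sup>2 = 1024 * (L * V) / \<epsilon>"
      using L V \<epsilon> by (simp add: power_mult_distrib power_divide)
    ultimately have "1024 * (L * V) * (d / k)\<^sup>2 \<le> \<epsilon> * (K\<^sup>2 * (c * P))"
      using \<epsilon> by (simp add: pos_divide_le_eq mult.commute)
    then have "1024 * (L * V) * (d / k)\<^sup>2 / (K\<^sup>2 * (c * P)) \<le> \<epsilon>"
      using inv_step_pos c P by (simp add: pos_divide_le_eq)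
    then show ?thesis by (simp add: power_divide mult_ac)
  qed
  ultimately show ?thesis by linarith
qed

text \<open>As \<open>c \<le> 1\<close>, \<open>sqrt c\<close> dominates \<open>c\<close>; this
  allows the single prefactor \<open>1 / c\<close> in \<open>inv_step_le\<close>.\<close>

lemma inverse_sqrt_mult_le: "1 / sqrt (c * P) \<le> 1 / c * (1 / sqrt P)"
proof -
  have "c * sqrt P \<le> sqrt c * sqrt P"
    using c P by (intro mult_right_mono real_le_rsqrt) (auto simp: power2_eq_square)
  then show ?thesis
    using c P by (simp add: real_sqrt_mult frac_le)
qed

lemma inv_step_le:
  "K \<le> 64 / c * (L + V / (P * \<epsilon>) + \<mu> * d / k + d / (k * sqrt P) * (L + sqrt (L * V) / sqrt \<epsilon>))"
proof -
  have c1: "1 \<le> 1 / c" using c by simp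
  have "16 * L \<le> 64 / c * L"
    using c L by (intro mult_right_mono) (auto simp: field_simps)
  moreover have "8 * V / (P * \<epsilon>) \<le> 64 / c * (V / (P * \<epsilon>))"
    using mult_right_mono[of 8 "64 / c" "V / (P * \<epsilon>)"] c V P \<epsilon> by (simp add: field_simps)
  moreover have "2 * \<mu> * d / (c * k) \<le> 64 / c * (\<mu> * d / k)"
    using c \<mu> k by (simp add: field_simps)
  moreover have "d / (k * sqrt (c * P)) * (64 * L + 32 * sqrt (L * V) / sqrt \<epsilon>)
    \<le> 64 / c * (d / (k * sqrt P) * (L + sqrt (L * V) / sqrt \<epsilon>))"
  proof -
    have "d / k * (1 / sqrt (c * P)) * (64 * L + 32 * sqrt (L * V) / sqrt \<epsilon>)
      \<le> d / k * (1 / c * (1 / sqrt P)) * (64 * L + 64 * (sqrt (L * V) / sqrt \<epsilon>))"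
      using c P k L V \<epsilon> inverse_sqrt_mult_le
      by (intro mult_mono mult_left_mono add_mono) (auto simp: divide_right_mono)
    also have "\<dots> = 64 / c * (d / (k * sqrt P) * (L + sqrt (L * V) / sqrt \<epsilon>))"
      by (simp add: field_simps)
    finally show ?thesis by simp
  qed
  ultimately show ?thesis unfolding inv_step_def distrib_left by linarith
qed

text \<open>\<open>X\<close> is the argument of the logarithmic factor and dominates every
  parameter. Hence the ratio that the exponential must beat is polynomial in \<open>X\<close>, and a
  multiple of \<open>ln X\<close> in the exponent suffices.\<close>

lemma inv_step_poly:
  assumes X: "X = 3 + L + \<mu> + V + P + d + k + 1 / \<epsilon> + R" and R: "R \<ge> 0"
  shows "4 * R\<^sup>2 * K / \<epsilon> \<le> 1280 / c * X ^ 6"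
proof -
  have i: "0 < 1 / \<epsilon>" using \<epsilon> by simp
  have le: "L \<le> X" "V \<le> X" "\<mu> \<le> X" "d \<le> X" "1 / \<epsilon> \<le> X" "R \<le> X" "1 \<le> X"
    using X R L \<mu> V P k i by auto
  have 1: "L \<le> X ^ 3"
    using le self_le_power[of X 3] by linarith
  have "V / (P * \<epsilon>) = V * (1 / \<epsilon>) * (1 / P)" by simp
  also have "\<dots> \<le> X * X * X"
  proof (intro mult_mono)
    have "1 / P \<le> 1" using P by simp
    then show "1 / P \<le> X" using le by linarith
  qed (use le V P i in auto)
  finally have 2: "V / (P * \<epsilon>) \<le> X ^ 3" by (simp add: power3_eq_cube)
  have "d / k \<le> d / 1" using k by (intro divide_left_mono) auto
  then have dk: "d / k \<le> X" using le by simp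
  have "\<mu> * (d / k) * 1 \<le> X * X * X" using le dk \<mu> k by (intro mult_mono) auto
  then have 3: "\<mu> * d / k \<le> X ^ 3" by (simp add: power3_eq_cube)
  have "sqrt (L * V) \<le> sqrt (X * X)" using le L V by (intro real_sqrt_le_mono mult_mono) auto
  then have s1: "sqrt (L * V) \<le> X" using le by simp
  have "1 / sqrt \<epsilon> = sqrt (1 / \<epsilon>)" by (simp add: real_sqrt_divide)
  also have "\<dots> \<le> sqrt (X * X)"
    using le mult_mono[of "1 / \<epsilon>" X 1 X] i by (intro real_sqrt_le_mono) auto
  finally have s2: "1 / sqrt \<epsilon> \<le> X" using le by simp
  have "sqrt (L * V) * (1 / sqrt \<epsilon>) \<le> X * X" using s1 s2 le \<epsilon> by (intro mult_mono) auto
  moreover have "L * 1 \<le> X * X" using le L by (intro mult_mono) auto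
  ultimately have s3: "L + sqrt (L * V) / sqrt \<epsilon> \<le> 2 * (X * X)" by simp
  have "d / k * (1 / sqrt P) \<le> X * 1" using dk k P le by (intro mult_mono) auto
  then have "d / (k * sqrt P) * (L + sqrt (L * V) / sqrt \<epsilon>) \<le> X * (2 * (X * X))"
    using s3 le L V \<epsilon> by (intro mult_mono) auto
  then have 4: "d / (k * sqrt P) * (L + sqrt (L * V) / sqrt \<epsilon>) \<le> 2 * X ^ 3" by (simp add: power3_eq_cube)
  have "K \<le> 64 / c * (L + V / (P * \<epsilon>) + \<mu> * d / k + d / (k * sqrt P) * (L + sqrt (L * V) / sqrt \<epsilon>))"
    by (rule inv_step_le)
  \<comment> \<open>The four summands are at most \<open>X ^ 3\<close> three times and
    \<open>2 * X ^ 3\<close> once.\<close>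
  also have "\<dots> \<le> 64 / c * (5 * X ^ 3)"
    using c 1 2 3 4 by (intro mult_left_mono) auto
  finally have K: "K \<le> 64 / c * (5 * X ^ 3)" .
  have "R\<^sup>2 * (1 / \<epsilon>) \<le> X\<^sup>2 * X" using le R i by (intro mult_mono power_mono) auto
  then have "4 * (R\<^sup>2 * (1 / \<epsilon>)) \<le> 4 * (X\<^sup>2 * X)" by simp
  then have "(4 * (R\<^sup>2 * (1 / \<epsilon>))) * K \<le> (4 * (X\<^sup>2 * X)) * (64 / c * (5 * X ^ 3))"
    by (rule mult_mono) (use K inv_step_pos le in auto)
  then show ?thesis by (simp add: power_numeral_reduce mult_ac)
qed

end

text \<open>\<open>A0\<close> and \<open>q0\<close> express "sufficiently large", \<open>A\<close>
  and \<open>q\<close> the upper end of the range of \<open>T\<close>. All constants are fixed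
  before the problem, hence absolute; only \<eta> may depend on it. Since
  \<open>\<Lambda> \<ge> 1\<close> and \<open>\<eta> * \<mu> < 1\<close>, the condition
  \<open>A \<ge> 2 * A0\<close> makes the range at least 1 long, so it contains an integer
  \<open>T\<close>.\<close>

theorem theoremA8:
  shows "\<exists>c0>0. \<forall>c::real. 0 < c \<and> c \<le> c0 \<longrightarrow>
    (\<exists>A0\<ge>1. \<exists>q0::nat. \<forall>A\<ge>2 * A0. \<forall>q\<ge>q0. \<exists>C>0. \<exists>r::nat.
      \<forall>(d::nat) (N::nat) (P::nat) (k::nat) (f :: nat \<Rightarrow> nat \<Rightarrow> fsvec \<Rightarrow> real)
        (L::real) (\<mu>::real) (V::real) (x_in::fsvec) (x_star::fsvec).
        d \<ge> 1 \<and> N \<ge> 1 \<and> P \<ge> 1 \<and> 1 \<le> k \<and> k \<le> d \<and> L > 0 \<and> \<mu> > 0 \<and>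
        x_in \<in> Rd d \<and> x_star \<in> Rd d \<and>
        (\<forall>i\<in>{1..N}. \<forall>p\<in>{1..P}. f i p differentiable_on Rd d) \<and>
        (\<forall>y\<in>Rd d. avg_obj N P f x_star \<le> avg_obj N P f y) \<and>
        L_smooth d L (avg_obj N P f) \<and>
        bounded_variance d N P V f \<and>
        strongly_convex d \<mu> (avg_obj N P f) \<longrightarrow>
        (\<forall>\<epsilon>>0. \<exists>\<eta>>0. \<eta> * \<mu> < 1 \<and>
          (let \<Lambda> = log_factor L \<mu> V P d k \<epsilon> (norm (x_in - x_star)) in
            \<forall>T::nat. A0 * \<Lambda> ^ q0 / (\<eta> * \<mu>) \<le> real T \<and> real T \<le> A * \<Lambda> ^ q / (\<eta> * \<mu>) \<longrightarrow>
              measure_pmf.expectation (x_out d N P k (c * real k / real d) f \<eta> \<mu> x_in T)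
                (\<lambda>x. avg_obj N P f x - avg_obj N P f x_star) \<le> \<epsilon> \<and>
              real T \<le> C * \<Lambda> ^ r *
                (L / \<mu> + V / real P * (1 / (\<mu> * \<epsilon>)) + real d / real k
                 + real d / (real k * sqrt (real P)) * (L / \<mu> + sqrt (L * V) / (\<mu> * sqrt \<epsilon>))))))"
proof (rule exI[of _ "1 / 8"], intro conjI allI impI)
  fix c :: real
  assume "0 < c \<and> c \<le> 1 / 8"
  then have c: "0 < c" "c \<le> 1 / 8" by auto
  \<comment> \<open>As \<open>X \<ge> 3\<close>, the constant \<open>1280 / c\<close> is absorbed
    into \<open>X ^ n\<close>; with the degree 6 of the polynomial bound this gives the exponent
    \<open>A0 = 6 + n\<close>.\<close>
  obtain n :: nat where "1280 / c < 3 ^ n"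
    using real_arch_pow[of 3 "1280 / c"] by auto
  then have n: "1280 / c \<le> 3 ^ n" by simp
  define A0 :: real where "A0 = real (6 + n)"
  show "\<exists>A0\<ge>1. \<exists>q0::nat. \<forall>A\<ge>2 * A0. \<forall>q\<ge>q0. \<exists>C>0. \<exists>r::nat.
      \<forall>(d::nat) (N::nat) (P::nat) (k::nat) (f :: nat \<Rightarrow> nat \<Rightarrow> fsvec \<Rightarrow> real)
        (L::real) (\<mu>::real) (V::real) (x_in::fsvec) (x_star::fsvec).
        d \<ge> 1 \<and> N \<ge> 1 \<and> P \<ge> 1 \<and> 1 \<le> k \<and> k \<le> d \<and> L > 0 \<and> \<mu> > 0 \<and>
        x_in \<in> Rd d \<and> x_star \<in> Rd d \<and>
        (\<forall>i\<in>{1..N}. \<forall>p\<in>{1..P}. f i p differentiable_on Rd d) \<and>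
        (\<forall>y\<in>Rd d. avg_obj N P f x_star \<le> avg_obj N P f y) \<and>
        L_smooth d L (avg_obj N P f) \<and>
        bounded_variance d N P V f \<and>
        strongly_convex d \<mu> (avg_obj N P f) \<longrightarrow>
        (\<forall>\<epsilon>>0. \<exists>\<eta>>0. \<eta> * \<mu> < 1 \<and>
          (let \<Lambda> = log_factor L \<mu> V P d k \<epsilon> (norm (x_in - x_star)) in
            \<forall>T::nat. A0 * \<Lambda> ^ q0 / (\<eta> * \<mu>) \<le> real T \<and> real T \<le> A * \<Lambda> ^ q / (\<eta> * \<mu>) \<longrightarrow>
              measure_pmf.expectation (x_out d N P k (c * real k / real d) f \<eta> \<mu> x_in T)
                (\<lambda>x. avg_obj N P f x - avg_obj N P f x_star) \<le> \<epsilon> \<and>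
              real T \<le> C * \<Lambda> ^ r *
                (L / \<mu> + V / real P * (1 / (\<mu> * \<epsilon>)) + real d / real k
                 + real d / (real k * sqrt (real P)) * (L / \<mu> + sqrt (L * V) / (\<mu> * sqrt \<epsilon>)))))"
  \<comment> \<open>One logarithm is enough, so \<open>q0\<close> is 1.\<close>
  proof (rule exI[of _ A0], rule conjI[OF _ exI[of _ 1]], goal_cases)
    case 1
    show ?case by (simp add: A0_def)
  next
    case 2
    show ?case
    proof (intro allI impI, goal_cases)
      case (1 A q)
      then have A: "A > 0" by (simp add: A0_def)
      show ?case
      \<comment> \<open>\<open>T\<close> is at most \<open>A * \<Lambda> ^ q * K / \<mu>\<close>,
        and \<open>inv_step_le\<close> bounds \<open>K / \<mu>\<close> by \<open>64 / c\<close>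
        times the claimed complexity.\<close>
      proof (rule exI[of _ "A * (64 / c)"], rule conjI[OF _ exI[of _ q]], goal_cases)
        case 1
        show ?case using A c by simp
      next
        case 2
        show ?case
        proof (intro allI impI, goal_cases)
          case prems: (1 d N P k f L \<mu> V x_in x_star \<epsilon>)
          interpret ef_problem d N P k f L \<mu> V x_star
            using prems(1) by unfold_locales auto
          have x_in: "x_in \<in> Rd d" using prems(1) by simp
          define K where "K = inv_step c L \<mu> V P d k \<epsilon>"
          have P': "real P \<ge> 1" "1 \<le> real k" "real k \<le> real d" using P k by auto
          note assms' = c L \<mu> V_nonneg P' prems(2)
          define \<eta> where "\<eta> = 1 / K"
          have K: "K > 0" unfolding K_def by (rule inv_step_pos[OF assms'])
          have \<eta>: "\<eta> > 0" using K by (simp add: \<eta>_def)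
          interpret ef_run d N P k f L \<mu> V x_star c \<eta> x_in
          proof
            show "16 * L * \<eta> \<le> 1"
              using inv_step_ge(1)[OF assms'] K by (simp add: \<eta>_def K_def)
            show "2 * (\<eta> * \<mu>) \<le> c * real k / real d"
              unfolding \<eta>_def K_def by (rule inv_step_\<mu>[OF assms'])
            show "2048 * \<eta>\<^sup>2 * L\<^sup>2 * (real d / real k)\<^sup>2 \<le> c * real P"
              unfolding \<eta>_def K_def by (rule inv_step_P[OF assms'])
          qed (use c \<eta> x_in in auto)
          define R where "R = norm (x_in - x_star)"
          define X where "X = 3 + L + \<mu> + V + real P + real d + real k + 1 / \<epsilon> + R"
          define \<Lambda> where "\<Lambda> = log_factor L \<mu> V P d k \<epsilon> R"
          have \<Lambda>: "\<Lambda> = ln X" by (simp add: \<Lambda>_def log_factor_def X_def)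
          have X: "X \<ge> 3" using L \<mu> V_nonneg prems(2) by (simp add: X_def R_def)
          then have \<Lambda>_pos: "\<Lambda> > 0" by (simp add: \<Lambda>)
          show ?case
            unfolding Let_def R_def[symmetric] \<Lambda>_def[symmetric]
          proof (rule exI[of _ \<eta>], intro conjI allI impI)
            show "\<eta> > 0" "\<eta> * \<mu> < 1" using \<eta> \<eta>\<mu>_bounds by auto
          next
            fix T :: nat
            assume "A0 * \<Lambda> ^ 1 / (\<eta> * \<mu>) \<le> real T \<and> real T \<le> A * \<Lambda> ^ q / (\<eta> * \<mu>)"
            then have T: "A0 * \<Lambda> / (\<eta> * \<mu>) \<le> real T" "real T \<le> A * \<Lambda> ^ q / (\<eta> * \<mu>)" by auto
            have "0 < A0 * \<Lambda> / (\<eta> * \<mu>)"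
              using \<Lambda>_pos \<eta>\<mu>_bounds by (simp add: A0_def)
            with T(1) have T1: "T \<ge> 1" by (cases T) auto
            have "4 * R\<^sup>2 * K / \<epsilon> \<le> 1280 / c * X ^ 6"
              unfolding K_def by (rule inv_step_poly[OF assms' X_def]) (simp add: R_def)
            also have "\<dots> \<le> X ^ n * X ^ 6"
              using n X power_mono[of 3 X n] by (intro mult_right_mono) auto
            also have "\<dots> = exp (A0 * \<Lambda>)"
              unfolding A0_def exp_of_nat_mult \<Lambda> using X by (simp add: power_add mult.commute)
            also have "\<dots> \<le> exp (\<eta> * \<mu> * real T)"
              using T(1) \<eta>\<mu>_bounds by (simp add: pos_divide_le_eq mult.commute)
            finally have "4 * R\<^sup>2 * K / \<epsilon> \<le> exp (\<eta> * \<mu> * real T)" .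
            \<comment> \<open>The starting point contributes at most half of the accuracy, the noise
              the other half.\<close>
            then have bias: "2 * R\<^sup>2 / (\<eta> * exp (\<eta> * \<mu> * real T)) \<le> \<epsilon> / 2"
              using prems(2) K by (simp add: \<eta>_def field_simps)
            have "2 * noise / \<eta> = 2 * (\<eta> * V / real P)
                + 256 * (\<eta>\<^sup>2 * L * V * (real d / real k)\<^sup>2 / (c * real P))"
              using \<eta> by (simp add: noise_def power2_eq_square power3_eq_cube distrib_left add_divide_distrib)
            also have "\<dots> \<le> \<epsilon> / 2"
              unfolding \<eta>_def K_def by (rule inv_step_noise[OF assms'])
            finally show "measure_pmf.expectation (x_out d N P k (c * real k / real d) f \<eta> \<mu> x_in T)
                (\<lambda>x. avg_obj N P f x - avg_obj N P f x_star) \<le> \<epsilon>"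
              using expectation_gap_out[OF T1] bias unfolding \<gamma>_def R_def by linarith
            have "real T \<le> A * \<Lambda> ^ q / \<mu> * K"
              using T(2) by (simp add: \<eta>_def)
            also have "\<dots> \<le> A * \<Lambda> ^ q / \<mu> * (64 / c * (L + V / (real P * \<epsilon>) + \<mu> * real d / real k
                + real d / (real k * sqrt (real P)) * (L + sqrt (L * V) / sqrt \<epsilon>)))"
              unfolding K_def using A \<Lambda>_pos \<mu>
              by (intro mult_left_mono inv_step_le[OF assms']) auto
            also have "\<dots> = A * (64 / c) * \<Lambda> ^ q * ((L + V / (real P * \<epsilon>) + \<mu> * real d / real k
                + real d / (real k * sqrt (real P)) * (L + sqrt (L * V) / sqrt \<epsilon>)) / \<mu>)"
              by (simp only: divide_inverse mult_ac)
            also have "(L + V / (real P * \<epsilon>) + \<mu> * real d / real k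
                + real d / (real k * sqrt (real P)) * (L + sqrt (L * V) / sqrt \<epsilon>)) / \<mu>
              = L / \<mu> + V / real P * (1 / (\<mu> * \<epsilon>)) + real d / real k
                 + real d / (real k * sqrt (real P)) * (L / \<mu> + sqrt (L * V) / (\<mu> * sqrt \<epsilon>))"
              using \<mu> by (simp add: add_divide_distrib distrib_left mult_ac)
            finally show "real T \<le> A * (64 / c) * \<Lambda> ^ q *
                (L / \<mu> + V / real P * (1 / (\<mu> * \<epsilon>)) + real d / real k
                 + real d / (real k * sqrt (real P)) * (L / \<mu> + sqrt (L * V) / (\<mu> * sqrt \<epsilon>)))" .
          qed
        qed
      qed
    qed
  qed
qed simp

end
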